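(* Let $a>0$, $i_1,i_3>0$, $\mu_r>0$. Consider on $\{(\boldsymbol\omega,\boldsymbol\gamma)\in\mathbb R^3\times\mathbb R^3:(\boldsymbol\gamma,\boldsymbol\gamma)=1\}$ the system $$\mathbf J\dot{\boldsymbol\omega}+\boldsymbol\omega\times\mathbf I\boldsymbol\omega+\big((\boldsymbol\omega,\tfrac{d}{dt}(\boldsymbol r\times\boldsymbol\gamma))-1\big)\,\boldsymbol r\times\boldsymbol\gamma=-\mu_r\,\boldsymbol\gamma\times(\boldsymbol\omega\times\boldsymbol\gamma),\qquad \dot{\boldsymbol\gamma}+\boldsymbol\omega\times\boldsymbol\gamma=0 .$$ Permanent rotations of this system are motions with a constant inclination angle of the symmetry axis relative to the vertical, i.e. with $\gamma_3=\mathrm{const}$; they are given by the equations $\dot\gamma_3=0$, $\ddot\gamma_3=0$. Solving these equations, one finds the following partial solutions of the system: 1. Two one-parameter families of fixed points (parameter: the value $C$ of the area integral) $$\sigma_u:\ \gamma_3=1,\quad K_1=C,\quad K_2=0;\qquad\qquad \sigma_l:\ \gamma_3=-1,\quad K_1=-C,\quad K_2=0,$$ where $\omega_1=\omega_2=\gamma_1=\gamma_2=0$. They correspond to vertical rotations of the ball with the center of mass above ($\sigma_u$) or below ($\sigma_l$) the geometric center. 2. For $i_1\neq i_3$, a one-parameter family of periodic solutions $$\sigma_0:\quad \gamma_3=-\frac{a}{c_1^2(i_1-i_3)},\qquad K_1=\frac{a\,i_3}{c_1(i_1-i_3)},\qquad K_2=0,$$ where $c_1\in(-\infty,-c_0)\cup(c_0,\infty)$,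 $c_0=\sqrt{a/|i_1-i_3|}$, is the parameter of the family. These are periodic solutions of the system for $(\boldsymbol\omega,\boldsymbol\gamma)$, and correspond to fixed points of the reduced system for $(\gamma_3,K_1,K_2)$ obtained by factoring out rotations about the symmetry axis on a level set of $C$. This family corresponds to rotations of the ball in which its symmetry axis deviates from the vertical by the angle $\vartheta=\arccos\gamma_3$. In the variables $\boldsymbol\omega,\boldsymbol\gamma$ it is parameterized through $c_1$ (with $p=\sqrt{1-\gamma_3^2}$ and $\varphi$ the angle of rotation about the symmetry axis) as $$\omega_1=c_1p\cos\varphi,\quad \omega_2=c_1p\sin\varphi,\quad \omega_3=\frac{a}{c_1(i_1-i_3)},$$ $$\gamma_1=-p\cos\varphi,\quad \gamma_2=-p\sin\varphi,\quad \gamma_3=-\frac{a}{c_1^2(i_1-i_3)},$$ and the value of the area integral on it is $C=-c_1i_1+\dfrac{a^2}{c_1^3(i_1-i_3)}$.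
   Context: The system describes, in dimensionless variables (mass, radius and gravitational acceleration equal to $1$), the rolling with slipping of an axisymmetric unbalanced ball on a horizontal plane when the only dissipative action is the horizontal rolling resistance torque $-\mu_r\boldsymbol\omega_\bot$, $\boldsymbol\omega_\bot=\boldsymbol\omega-(\boldsymbol\omega,\boldsymbol\gamma)\boldsymbol\gamma$. Here $\boldsymbol\omega$ is the angular velocity and $\boldsymbol\gamma$ the upward vertical unit vector, both in axes attached to the ball with third axis along its symmetry axis. Notation: $\mathbf I=\mathrm{diag}(i_1,i_1,i_3)$ is the central tensor of inertia, $\boldsymbol a=(0,0,a)$ is the displacement of the center of mass from the geometric center, $\boldsymbol r=-\boldsymbol\gamma-\boldsymbol a$, $\mathbf J=\mathbf I+(\boldsymbol r\times\boldsymbol\gamma)\otimes(\boldsymbol r\times\boldsymbol\gamma)$ with $(\boldsymbol x\otimes\boldsymbol y)_{ij}=x_iy_j$. The area integral $C=(\mathbf J\boldsymbol\omega,\boldsymbol\gamma)=(\mathbf I\boldsymbol\omega,\boldsymbol\gamma)$ is a first integral. The variables used are $K_1=i_3\omega_3$, $K_2=\frac1k(\gamma_1\omega_2-\gamma_2\omega_1)$, $k=\sqrt{\frac{1-\gamma_3^2}{i_1+a^2(1-\gamma_3^2)}}$, $\varphi=\arctan(\gamma_2/\gamma_1)$; on the vertical rotations, where $k=0$, the condition $K_2=0$ is to be read together with $\omega_1=\omega_2=0$. *)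

theory Defs
  imports "HOL-Analysis.Analysis" "HOL-Library.Periodic_Fun"
begin

unbundle cross3_syntax

section \<open>The rolling ball with rolling resistance\<close>

text \<open>
  All vectors are given in axes attached to the ball, the third axis being its symmetry axis.
  Parameters: \<open>i1\<close>, \<open>i3\<close> are the central moments of inertia, \<open>a\<close> is the displacement of the center
  of mass along the symmetry axis and \<open>\<mu>\<close> is the coefficient of rolling resistance. A state is a
  pair of the angular velocity \<open>\<omega>\<close> and the upward vertical unit vector \<open>\<gamma>\<close>.
\<close>

definition inertia_tensor :: "real \<Rightarrow> real \<Rightarrow> real^3^3"
  where "inertia_tensor i1 i3 = (\<chi> i j. if i = j then (vector [i1, i1, i3] :: real^3) $ i else 0)"

definition mass_offset :: "real \<Rightarrow> real^3"
  where "mass_offset a = vector [0, 0, a]"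

definition contact_vector :: "real \<Rightarrow> real^3 \<Rightarrow> real^3"
  where "contact_vector a \<gamma> = - \<gamma> - mass_offset a"

definition outer_product :: "real^3 \<Rightarrow> real^3 \<Rightarrow> real^3^3"
  where "outer_product x y = (\<chi> i j. x $ i * y $ j)"

definition J_tensor :: "real \<Rightarrow> real \<Rightarrow> real \<Rightarrow> real^3 \<Rightarrow> real^3^3"
  where "J_tensor i1 i3 a \<gamma> =
    inertia_tensor i1 i3 +
      outer_product (contact_vector a \<gamma> \<times> \<gamma>) (contact_vector a \<gamma> \<times> \<gamma>)"

text \<open>
  A motion is considered on a nonempty open time interval \<open>T\<close>, possibly the whole line.
\<close>

definition rolling_motion ::
    "real \<Rightarrow> real \<Rightarrow> real \<Rightarrow> real \<Rightarrow> real set \<Rightarrow> (real \<Rightarrow> real^3) \<Rightarrow> (real \<Rightarrow> real^3) \<Rightarrow> bool"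
  where "rolling_motion i1 i3 a \<mu> T \<omega> \<gamma> \<longleftrightarrow>
    open T \<and> is_interval T \<and> T \<noteq> {} \<and>
    (\<forall>t\<in>T.
      \<gamma> t \<bullet> \<gamma> t = 1 \<and>
      \<omega> differentiable (at t) \<and> \<gamma> differentiable (at t) \<and>
      J_tensor i1 i3 a (\<gamma> t) *v vector_derivative \<omega> (at t)
        + \<omega> t \<times> (inertia_tensor i1 i3 *v \<omega> t)
        + (\<omega> t \<bullet> vector_derivative (\<lambda>s. contact_vector a (\<gamma> s) \<times> \<gamma> s) (at t) - 1)
            *\<^sub>R (contact_vector a (\<gamma> t) \<times> \<gamma> t)
        = - \<mu> *\<^sub>R (\<gamma> t \<times> (\<omega> t \<times> \<gamma> t)) \<and>
      vector_derivative \<gamma> (at t) + \<omega> t \<times> \<gamma> t = 0)"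

definition fixed_point :: "real \<Rightarrow> real \<Rightarrow> real \<Rightarrow> real \<Rightarrow> real^3 \<Rightarrow> real^3 \<Rightarrow> bool"
  where "fixed_point i1 i3 a \<mu> \<omega> \<gamma> \<longleftrightarrow> rolling_motion i1 i3 a \<mu> UNIV (\<lambda>_. \<omega>) (\<lambda>_. \<gamma>)"

definition area_integral :: "real \<Rightarrow> real \<Rightarrow> real \<Rightarrow> real^3 \<Rightarrow> real^3 \<Rightarrow> real"
  where "area_integral i1 i3 a \<omega> \<gamma> = (J_tensor i1 i3 a \<gamma> *v \<omega>) \<bullet> \<gamma>"

definition permanent_rotation ::
    "real \<Rightarrow> real \<Rightarrow> real \<Rightarrow> real \<Rightarrow> real set \<Rightarrow> (real \<Rightarrow> real^3) \<Rightarrow> (real \<Rightarrow> real^3) \<Rightarrow> bool"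
  where "permanent_rotation i1 i3 a \<mu> T \<omega> \<gamma> \<longleftrightarrow>
    rolling_motion i1 i3 a \<mu> T \<omega> \<gamma> \<and> (\<lambda>t. \<gamma> t $ 3) constant_on T"

text \<open>The angle between the symmetry axis and the vertical.\<close>

definition inclination :: "real^3 \<Rightarrow> real"
  where "inclination \<gamma> = arccos ((axis 3 1 \<bullet> \<gamma>) / (norm (axis 3 1 :: real^3) * norm \<gamma>))"


section \<open>The variables \<open>\<gamma>\<^sub>3\<close>, \<open>K\<^sub>1\<close>, \<open>K\<^sub>2\<close> and the reduced system\<close>

definition k_factor :: "real \<Rightarrow> real \<Rightarrow> real \<Rightarrow> real"
  where "k_factor i1 a g = sqrt ((1 - g\<^sup>2) / (i1 + a\<^sup>2 * (1 - g\<^sup>2)))"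

definition K1 :: "real \<Rightarrow> real^3 \<Rightarrow> real"
  where "K1 i3 \<omega> = i3 * \<omega> $ 3"

text \<open>
  On vertical rotations \<open>k = 0\<close>, so that \<open>K2\<close> takes the junk value \<open>0\<close>; the definitions of the
  families of vertical rotations below add \<open>\<omega>\<^sub>1 = \<omega>\<^sub>2 = 0\<close> to the condition \<open>K2 = 0\<close>.
\<close>

definition K2 :: "real \<Rightarrow> real \<Rightarrow> real^3 \<Rightarrow> real^3 \<Rightarrow> real"
  where "K2 i1 a \<omega> \<gamma> = 1 / k_factor i1 a (\<gamma> $ 3) * (\<gamma> $ 1 * \<omega> $ 2 - \<gamma> $ 2 * \<omega> $ 1)"

definition reduced_state ::
    "real \<Rightarrow> real \<Rightarrow> real \<Rightarrow> real^3 \<Rightarrow> real^3 \<Rightarrow> real * real * real"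
  where "reduced_state i1 i3 a \<omega> \<gamma> = (\<gamma> $ 3, K1 i3 \<omega>, K2 i1 a \<omega> \<gamma>)"

text \<open>
  The vector field induced on the variables \<open>(\<gamma>\<^sub>3, K\<^sub>1, K\<^sub>2)\<close>, \<open>\<bar>\<gamma>\<^sub>3\<bar> < 1\<close>, on the level set \<open>C\<close> of the
  area integral. That it is induced by the full system is \<open>reduced_system\<close> below, and that its
  phase space is the quotient of the level set by the rotations about the symmetry axis is
  \<open>reduced_state_eq_iff\<close>.
\<close>

definition reduced_field ::
    "real \<Rightarrow> real \<Rightarrow> real \<Rightarrow> real \<Rightarrow> real \<Rightarrow> real * real * real \<Rightarrow> real * real * real"
  where "reduced_field i1 i3 a \<mu> C = (\<lambda>(g, \<kappa>1, \<kappa>2).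
    (k_factor i1 a g * \<kappa>2,
     - \<mu> * (\<kappa>1 * (1 - g\<^sup>2) / i3 - g * (C - \<kappa>1 * g) / i1),
     k_factor i1 a g * ((C - \<kappa>1 * g) * (\<kappa>1 - C * g) / (i1 * (1 - g\<^sup>2)\<^sup>2) - a)
       - \<mu> * \<kappa>2 / (i1 + a\<^sup>2 * (1 - g\<^sup>2))))"

definition reduced_fixed_point ::
    "real \<Rightarrow> real \<Rightarrow> real \<Rightarrow> real \<Rightarrow> real \<Rightarrow> real * real * real \<Rightarrow> bool"
  where "reduced_fixed_point i1 i3 a \<mu> C y \<longleftrightarrow>
    \<bar>fst y\<bar> < 1 \<and> reduced_field i1 i3 a \<mu> C y = 0"

definition axis_rotation :: "real \<Rightarrow> real^3 \<Rightarrow> real^3"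
  where "axis_rotation \<theta> x =
    vector [cos \<theta> * x $ 1 - sin \<theta> * x $ 2, sin \<theta> * x $ 1 + cos \<theta> * x $ 2, x $ 3]"


section \<open>The families of permanent rotations\<close>

text \<open>The families are given as sets of states.\<close>

definition sigma_u :: "real \<Rightarrow> real \<Rightarrow> real \<Rightarrow> real \<Rightarrow> ((real^3) * (real^3)) set"
  where "sigma_u i1 i3 a C = {(\<omega>, \<gamma>). \<gamma> \<bullet> \<gamma> = 1 \<and>
    \<gamma> $ 3 = 1 \<and> K1 i3 \<omega> = C \<and> K2 i1 a \<omega> \<gamma> = 0 \<and> \<omega> $ 1 = 0 \<and> \<omega> $ 2 = 0}"

definition sigma_l :: "real \<Rightarrow> real \<Rightarrow> real \<Rightarrow> real \<Rightarrow> ((real^3) * (real^3)) set"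
  where "sigma_l i1 i3 a C = {(\<omega>, \<gamma>). \<gamma> \<bullet> \<gamma> = 1 \<and>
    \<gamma> $ 3 = - 1 \<and> K1 i3 \<omega> = - C \<and> K2 i1 a \<omega> \<gamma> = 0 \<and> \<omega> $ 1 = 0 \<and> \<omega> $ 2 = 0}"

definition sigma0_params :: "real \<Rightarrow> real \<Rightarrow> real \<Rightarrow> real set"
  where "sigma0_params i1 i3 a =
    (let c0 = sqrt (a / \<bar>i1 - i3\<bar>) in {..< - c0} \<union> {c0 <..})"

definition sigma0_gamma3 :: "real \<Rightarrow> real \<Rightarrow> real \<Rightarrow> real \<Rightarrow> real"
  where "sigma0_gamma3 i1 i3 a c1 = - a / (c1\<^sup>2 * (i1 - i3))"

definition sigma0_K1 :: "real \<Rightarrow> real \<Rightarrow> real \<Rightarrow> real \<Rightarrow> real"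
  where "sigma0_K1 i1 i3 a c1 = a * i3 / (c1 * (i1 - i3))"

definition sigma0_C :: "real \<Rightarrow> real \<Rightarrow> real \<Rightarrow> real \<Rightarrow> real"
  where "sigma0_C i1 i3 a c1 = - c1 * i1 + a\<^sup>2 / (c1 ^ 3 * (i1 - i3))"

definition sigma0_omega :: "real \<Rightarrow> real \<Rightarrow> real \<Rightarrow> real \<Rightarrow> real \<Rightarrow> real^3"
  where "sigma0_omega i1 i3 a c1 \<phi> =
    (let p = sqrt (1 - (sigma0_gamma3 i1 i3 a c1)\<^sup>2)
     in vector [c1 * p * cos \<phi>, c1 * p * sin \<phi>, a / (c1 * (i1 - i3))])"

definition sigma0_gamma :: "real \<Rightarrow> real \<Rightarrow> real \<Rightarrow> real \<Rightarrow> real \<Rightarrow> real^3"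
  where "sigma0_gamma i1 i3 a c1 \<phi> =
    (let p = sqrt (1 - (sigma0_gamma3 i1 i3 a c1)\<^sup>2)
     in vector [- p * cos \<phi>, - p * sin \<phi>, sigma0_gamma3 i1 i3 a c1])"

text \<open>
  Here \<open>tan \<phi> = \<gamma>\<^sub>2 / \<gamma>\<^sub>1\<close>. The angle runs over the whole circle, whereas the principal value of
  the arctangent would only give the states with \<open>\<gamma>\<^sub>1 < 0\<close>.
\<close>

definition sigma_0 :: "real \<Rightarrow> real \<Rightarrow> real \<Rightarrow> real \<Rightarrow> ((real^3) * (real^3)) set"
  where "sigma_0 i1 i3 a c1 =
    {(sigma0_omega i1 i3 a c1 \<phi>, sigma0_gamma i1 i3 a c1 \<phi>) | \<phi>. True}"


section \<open>The reduced system is induced by the full system\<close>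

lemma contact_cross: "contact_vector a \<gamma> \<times> \<gamma> = vector [a * \<gamma> $ 2, - a * \<gamma> $ 1, 0]"
  by (simp add: contact_vector_def mass_offset_def cross3_def vec_eq_iff forall_3 algebra_simps)

lemma inertia_mult: "inertia_tensor i1 i3 *v x = vector [i1 * x $ 1, i1 * x $ 2, i3 * x $ 3]"
  by (simp add: inertia_tensor_def matrix_vector_mult_def vec_eq_iff forall_3 sum_3)

lemma J_mult:
  "J_tensor i1 i3 a \<gamma> *v x = inertia_tensor i1 i3 *v x +
     ((contact_vector a \<gamma> \<times> \<gamma>) \<bullet> x) *\<^sub>R (contact_vector a \<gamma> \<times> \<gamma>)"
  by (simp add: J_tensor_def outer_product_def matrix_vector_mult_def vec_eq_iff forall_3 sum_3
      inner_vec_def algebra_simps)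

lemma area_integral_eq: "area_integral i1 i3 a \<omega> \<gamma> = (inertia_tensor i1 i3 *v \<omega>) \<bullet> \<gamma>"
  by (simp add: area_integral_def J_mult inner_add_left dot_cross_self)

lemma area_integral_coords:
  "area_integral i1 i3 a \<omega> \<gamma> = i1 * (\<omega> $ 1 * \<gamma> $ 1 + \<omega> $ 2 * \<gamma> $ 2) + i3 * \<omega> $ 3 * \<gamma> $ 3"
  by (simp add: area_integral_eq inertia_mult inner_vec_def sum_3 algebra_simps)

lemma has_real_derivative_component:
  fixes f :: "real \<Rightarrow> real^3"
  assumes "(f has_vector_derivative f') (at t)"
  shows "((\<lambda>s. f s $ i) has_real_derivative f' $ i) (at t)"
  using bounded_linear.has_vector_derivative[OF bounded_linear_vec_nth assms]
  by (simp add: has_real_derivative_iff_has_vector_derivative)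

lemma rolling_motion_coords:
  assumes "rolling_motion i1 i3 a \<mu> T \<omega> \<gamma>" and "t \<in> T"
  obtains \<alpha>1 \<alpha>2 \<alpha>3 \<sigma> where
    "((\<lambda>s. \<omega> s $ 1) has_real_derivative \<alpha>1) (at t)"
    "((\<lambda>s. \<omega> s $ 2) has_real_derivative \<alpha>2) (at t)"
    "((\<lambda>s. \<omega> s $ 3) has_real_derivative \<alpha>3) (at t)"
    "((\<lambda>s. \<gamma> s $ 1) has_real_derivative \<omega> t $ 3 * \<gamma> t $ 2 - \<omega> t $ 2 * \<gamma> t $ 3) (at t)"
    "((\<lambda>s. \<gamma> s $ 2) has_real_derivative \<omega> t $ 1 * \<gamma> t $ 3 - \<omega> t $ 3 * \<gamma> t $ 1) (at t)"
    "((\<lambda>s. \<gamma> s $ 3) has_real_derivative \<gamma> t $ 1 * \<omega> t $ 2 - \<gamma> t $ 2 * \<omega> t $ 1) (at t)"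
    "(\<gamma> t $ 1)\<^sup>2 + (\<gamma> t $ 2)\<^sup>2 + (\<gamma> t $ 3)\<^sup>2 = 1"
    "\<sigma> = a * (\<gamma> t $ 2 * \<alpha>1 - \<gamma> t $ 1 * \<alpha>2)
         + a * (\<omega> t $ 1 * (\<omega> t $ 1 * \<gamma> t $ 3 - \<omega> t $ 3 * \<gamma> t $ 1)
              - \<omega> t $ 2 * (\<omega> t $ 3 * \<gamma> t $ 2 - \<omega> t $ 2 * \<gamma> t $ 3))"
    "i1 * \<alpha>1 + (i3 - i1) * \<omega> t $ 2 * \<omega> t $ 3 + (\<sigma> - 1) * a * \<gamma> t $ 2
       = - \<mu> * (\<omega> t $ 1 - (\<omega> t \<bullet> \<gamma> t) * \<gamma> t $ 1)"
    "i1 * \<alpha>2 + (i1 - i3) * \<omega> t $ 1 * \<omega> t $ 3 - (\<sigma> - 1) * a * \<gamma> t $ 1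
       = - \<mu> * (\<omega> t $ 2 - (\<omega> t \<bullet> \<gamma> t) * \<gamma> t $ 2)"
    "i3 * \<alpha>3 = - \<mu> * (\<omega> t $ 3 - (\<omega> t \<bullet> \<gamma> t) * \<gamma> t $ 3)"
proof -
  let ?s = "\<lambda>u. contact_vector a (\<gamma> u) \<times> \<gamma> u"
  define \<alpha> where "\<alpha> = vector_derivative \<omega> (at t)"
  define \<beta> where "\<beta> = vector_derivative \<gamma> (at t)"
  have unit: "\<gamma> t \<bullet> \<gamma> t = 1"
    and dw: "(\<omega> has_vector_derivative \<alpha>) (at t)"
    and dg: "(\<gamma> has_vector_derivative \<beta>) (at t)"
    and eq1: "J_tensor i1 i3 a (\<gamma> t) *v \<alpha> + \<omega> t \<times> (inertia_tensor i1 i3 *v \<omega> t)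
        + (\<omega> t \<bullet> vector_derivative ?s (at t) - 1) *\<^sub>R ?s t = - \<mu> *\<^sub>R (\<gamma> t \<times> (\<omega> t \<times> \<gamma> t))"
    and eq2: "\<beta> + \<omega> t \<times> \<gamma> t = 0"
    using assms by (auto simp: rolling_motion_def \<alpha>_def \<beta>_def vector_derivative_works)
  have \<beta>: "\<beta> = - (\<omega> t \<times> \<gamma> t)"
    using eq2 by (simp add: add_eq_0_iff)
  have lin: "bounded_linear (\<lambda>x::real^3. vector [a * x $ 2, - a * x $ 1, 0] :: real^3)"
    by (rule linear_conv_bounded_linear[THEN iffD1], rule linearI)
       (simp_all add: vec_eq_iff forall_3 algebra_simps)
  have ds: "vector_derivative ?s (at t) = vector [a * \<beta> $ 2, - a * \<beta> $ 1, 0]"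
    unfolding contact_cross
    by (rule vector_derivative_at, rule bounded_linear.has_vector_derivative[OF lin dg])
  have triple: "\<gamma> t \<times> (\<omega> t \<times> \<gamma> t) = \<omega> t - (\<omega> t \<bullet> \<gamma> t) *\<^sub>R \<gamma> t"
    using unit by (simp add: Lagrange inner_commute)
  define \<sigma> where "\<sigma> = ?s t \<bullet> \<alpha> + \<omega> t \<bullet> vector_derivative ?s (at t)"
  have eq: "inertia_tensor i1 i3 *v \<alpha> + \<omega> t \<times> (inertia_tensor i1 i3 *v \<omega> t) + (\<sigma> - 1) *\<^sub>R ?s t
      = - \<mu> *\<^sub>R (\<omega> t - (\<omega> t \<bullet> \<gamma> t) *\<^sub>R \<gamma> t)"
    using eq1 unfolding triple by (simp add: J_mult \<sigma>_def algebra_simps)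
  have comp: "(inertia_tensor i1 i3 *v \<alpha> + \<omega> t \<times> (inertia_tensor i1 i3 *v \<omega> t)
        + (\<sigma> - 1) *\<^sub>R ?s t) $ i = (- \<mu> *\<^sub>R (\<omega> t - (\<omega> t \<bullet> \<gamma> t) *\<^sub>R \<gamma> t)) $ i" for i
    using eq by simp
  show thesis
  proof (rule that[of "\<alpha> $ 1" "\<alpha> $ 2" "\<alpha> $ 3" \<sigma>])
    show "((\<lambda>s. \<omega> s $ 1) has_real_derivative \<alpha> $ 1) (at t)"
      "((\<lambda>s. \<omega> s $ 2) has_real_derivative \<alpha> $ 2) (at t)"
      "((\<lambda>s. \<omega> s $ 3) has_real_derivative \<alpha> $ 3) (at t)"
      by (rule has_real_derivative_component[OF dw])+
    show "((\<lambda>s. \<gamma> s $ 1) has_real_derivative \<omega> t $ 3 * \<gamma> t $ 2 - \<omega> t $ 2 * \<gamma> t $ 3) (at t)"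
      using has_real_derivative_component[OF dg, of 1] by (simp add: \<beta> cross3_def)
    show "((\<lambda>s. \<gamma> s $ 2) has_real_derivative \<omega> t $ 1 * \<gamma> t $ 3 - \<omega> t $ 3 * \<gamma> t $ 1) (at t)"
      using has_real_derivative_component[OF dg, of 2] by (simp add: \<beta> cross3_def)
    show "((\<lambda>s. \<gamma> s $ 3) has_real_derivative \<gamma> t $ 1 * \<omega> t $ 2 - \<gamma> t $ 2 * \<omega> t $ 1) (at t)"
      using has_real_derivative_component[OF dg, of 3] by (simp add: \<beta> cross3_def mult.commute)
    show "(\<gamma> t $ 1)\<^sup>2 + (\<gamma> t $ 2)\<^sup>2 + (\<gamma> t $ 3)\<^sup>2 = 1"
      using unit by (simp add: inner_vec_def sum_3 power2_eq_square)
    show "\<sigma> = a * (\<gamma> t $ 2 * \<alpha> $ 1 - \<gamma> t $ 1 * \<alpha> $ 2)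
         + a * (\<omega> t $ 1 * (\<omega> t $ 1 * \<gamma> t $ 3 - \<omega> t $ 3 * \<gamma> t $ 1)
              - \<omega> t $ 2 * (\<omega> t $ 3 * \<gamma> t $ 2 - \<omega> t $ 2 * \<gamma> t $ 3))"
      unfolding \<sigma>_def ds \<beta>
      by (simp only: contact_cross) (simp add: cross3_def inner_vec_def sum_3 algebra_simps)
    show "i1 * \<alpha> $ 1 + (i3 - i1) * \<omega> t $ 2 * \<omega> t $ 3 + (\<sigma> - 1) * a * \<gamma> t $ 2
       = - \<mu> * (\<omega> t $ 1 - (\<omega> t \<bullet> \<gamma> t) * \<gamma> t $ 1)"
      using comp[of 1] unfolding contact_cross
      by (simp add: inertia_mult cross3_def algebra_simps)
    show "i1 * \<alpha> $ 2 + (i1 - i3) * \<omega> t $ 1 * \<omega> t $ 3 - (\<sigma> - 1) * a * \<gamma> t $ 1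
       = - \<mu> * (\<omega> t $ 2 - (\<omega> t \<bullet> \<gamma> t) * \<gamma> t $ 2)"
      using comp[of 2] unfolding contact_cross
      by (simp add: inertia_mult cross3_def algebra_simps)
    show "i3 * \<alpha> $ 3 = - \<mu> * (\<omega> t $ 3 - (\<omega> t \<bullet> \<gamma> t) * \<gamma> t $ 3)"
      using comp[of 3] unfolding contact_cross
      by (simp add: inertia_mult cross3_def algebra_simps)
  qed
qed

lemma has_real_derivative_k_factor:
  assumes "i1 > 0" and "\<bar>g\<bar> < 1"
  shows "k_factor i1 a g > 0"
    and "(k_factor i1 a g)\<^sup>2 * (i1 + a\<^sup>2 * (1 - g\<^sup>2)) = 1 - g\<^sup>2"
    and "(k_factor i1 a has_real_derivative
           - i1 * g * k_factor i1 a g / ((i1 + a\<^sup>2 * (1 - g\<^sup>2)) * (1 - g\<^sup>2))) (at g)"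
proof -
  define p2 where "p2 = 1 - g\<^sup>2"
  define D where "D = i1 + a\<^sup>2 * p2"
  define k where "k = k_factor i1 a g"
  have p2: "p2 > 0"
    using assms(2) by (simp add: p2_def abs_square_less_1)
  have D: "D > 0"
    using assms(1) p2 by (simp add: D_def add_pos_nonneg)
  have k_eq: "k = sqrt (p2 / D)"
    by (simp add: k_def k_factor_def p2_def D_def)
  have k: "k > 0" and k2: "k\<^sup>2 * D = p2"
    using p2 D by (simp_all add: k_eq)
  show "k_factor i1 a g > 0" and "(k_factor i1 a g)\<^sup>2 * (i1 + a\<^sup>2 * (1 - g\<^sup>2)) = 1 - g\<^sup>2"
    using k k2 by (simp_all add: k_def D_def p2_def)
  have "((\<lambda>x. (1 - x\<^sup>2) / (i1 + a\<^sup>2 * (1 - x\<^sup>2))) has_real_derivative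
      ((- 2 * g) * D - p2 * (a\<^sup>2 * (- 2 * g))) / (D * D)) (at g)"
    using D unfolding D_def p2_def by (auto intro!: derivative_eq_intros)
  also have "(- 2 * g) * D - p2 * (a\<^sup>2 * (- 2 * g)) = - 2 * g * i1"
    by (simp add: D_def algebra_simps)
  finally have "((\<lambda>x. sqrt ((1 - x\<^sup>2) / (i1 + a\<^sup>2 * (1 - x\<^sup>2)))) has_real_derivative
      inverse (sqrt (p2 / D)) / 2 * (- 2 * g * i1 / (D * D))) (at g)"
    using p2 D by (intro DERIV_chain2[where g = "\<lambda>x. (1 - x\<^sup>2) / (i1 + a\<^sup>2 * (1 - x\<^sup>2))"])
      (simp_all add: p2_def[symmetric] D_def[symmetric] DERIV_real_sqrt)
  also have "inverse (sqrt (p2 / D)) / 2 * (- 2 * g * i1 / (D * D)) = - i1 * g * k / (D * (k\<^sup>2 * D))"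
    using k D unfolding k_eq[symmetric] by (simp add: divide_simps power2_eq_square)
  finally show "(k_factor i1 a has_real_derivative
           - i1 * g * k_factor i1 a g / ((i1 + a\<^sup>2 * (1 - g\<^sup>2)) * (1 - g\<^sup>2))) (at g)"
    unfolding k2 by (simp add: k_factor_def[abs_def] k_def D_def p2_def)
qed

theorem reduced_system:
  assumes "i1 > 0" and "i3 > 0"
    and motion: "rolling_motion i1 i3 a \<mu> T \<omega> \<gamma>" and "t \<in> T" and "\<bar>\<gamma> t $ 3\<bar> < 1"
  shows "((\<lambda>s. reduced_state i1 i3 a (\<omega> s) (\<gamma> s)) has_vector_derivative
    reduced_field i1 i3 a \<mu> (area_integral i1 i3 a (\<omega> t) (\<gamma> t))
      (reduced_state i1 i3 a (\<omega> t) (\<gamma> t))) (at t)"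
proof -
  obtain \<alpha>1 \<alpha>2 \<alpha>3 \<sigma> where
    d1: "((\<lambda>s. \<omega> s $ 1) has_real_derivative \<alpha>1) (at t)" and
    d2: "((\<lambda>s. \<omega> s $ 2) has_real_derivative \<alpha>2) (at t)" and
    d3: "((\<lambda>s. \<omega> s $ 3) has_real_derivative \<alpha>3) (at t)" and
    g1: "((\<lambda>s. \<gamma> s $ 1) has_real_derivative \<omega> t $ 3 * \<gamma> t $ 2 - \<omega> t $ 2 * \<gamma> t $ 3) (at t)" and
    g2: "((\<lambda>s. \<gamma> s $ 2) has_real_derivative \<omega> t $ 1 * \<gamma> t $ 3 - \<omega> t $ 3 * \<gamma> t $ 1) (at t)" and
    g3: "((\<lambda>s. \<gamma> s $ 3) has_real_derivative \<gamma> t $ 1 * \<omega> t $ 2 - \<gamma> t $ 2 * \<omega> t $ 1) (at t)" and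
    unit: "(\<gamma> t $ 1)\<^sup>2 + (\<gamma> t $ 2)\<^sup>2 + (\<gamma> t $ 3)\<^sup>2 = 1" and
    \<sigma>: "\<sigma> = a * (\<gamma> t $ 2 * \<alpha>1 - \<gamma> t $ 1 * \<alpha>2)
         + a * (\<omega> t $ 1 * (\<omega> t $ 1 * \<gamma> t $ 3 - \<omega> t $ 3 * \<gamma> t $ 1)
              - \<omega> t $ 2 * (\<omega> t $ 3 * \<gamma> t $ 2 - \<omega> t $ 2 * \<gamma> t $ 3))" and
    e1: "i1 * \<alpha>1 + (i3 - i1) * \<omega> t $ 2 * \<omega> t $ 3 + (\<sigma> - 1) * a * \<gamma> t $ 2
       = - \<mu> * (\<omega> t $ 1 - (\<omega> t \<bullet> \<gamma> t) * \<gamma> t $ 1)" and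
    e2: "i1 * \<alpha>2 + (i1 - i3) * \<omega> t $ 1 * \<omega> t $ 3 - (\<sigma> - 1) * a * \<gamma> t $ 1
       = - \<mu> * (\<omega> t $ 2 - (\<omega> t \<bullet> \<gamma> t) * \<gamma> t $ 2)" and
    e3: "i3 * \<alpha>3 = - \<mu> * (\<omega> t $ 3 - (\<omega> t \<bullet> \<gamma> t) * \<gamma> t $ 3)"
    by (rule rolling_motion_coords[OF motion \<open>t \<in> T\<close>])
  define w1 w2 w3 x y g where "w1 = \<omega> t $ 1" and "w2 = \<omega> t $ 2" and "w3 = \<omega> t $ 3"
    and "x = \<gamma> t $ 1" and "y = \<gamma> t $ 2" and "g = \<gamma> t $ 3"
  note vars = w1_def[symmetric] w2_def[symmetric] w3_def[symmetric]
    x_def[symmetric] y_def[symmetric] g_def[symmetric]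
  define p2 where "p2 = 1 - g\<^sup>2"
  define D where "D = i1 + a\<^sup>2 * p2"
  define k where "k = k_factor i1 a g"
  define n where "n = w1 * x + w2 * y"
  define q where "q = x * w2 - y * w1"
  define q' where "q' = x * \<alpha>2 - y * \<alpha>1 + (w3 * y - w2 * g) * w2 - (w1 * g - w3 * x) * w1"
  define C where "C = area_integral i1 i3 a (\<omega> t) (\<gamma> t)"
  have g: "\<bar>g\<bar> < 1"
    using assms(5) by (simp add: g_def)
  have p2: "p2 > 0" and p2_eq: "p2 = x\<^sup>2 + y\<^sup>2"
    using g unit by (simp_all add: p2_def abs_square_less_1 vars algebra_simps)
  have D: "D > 0"
    using assms(1) p2 by (simp add: D_def add_pos_nonneg)
  note kf = has_real_derivative_k_factor[OF \<open>i1 > 0\<close> g, of a,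
      folded p2_def, folded D_def, folded k_def]
  have k: "k > 0" and k2: "k\<^sup>2 * D = p2"
    using kf by simp_all
  have dot: "\<omega> t \<bullet> \<gamma> t = n + w3 * g"
    by (simp add: inner_vec_def sum_3 vars n_def)
  have C: "C = i1 * n + i3 * w3 * g"
    by (simp add: C_def area_integral_coords vars n_def)
  have sigma: "\<sigma> = - a * q'"
    unfolding \<sigma> q'_def vars by (simp add: algebra_simps)

  have d_gamma3: "((\<lambda>s. \<gamma> s $ 3) has_real_derivative q) (at t)"
    using g3 by (simp add: vars q_def)

  have n_eq: "(C - i3 * w3 * g) / i1 = n"
    using \<open>i1 > 0\<close> by (simp add: C)
  have d_K1: "((\<lambda>s. K1 i3 (\<omega> s)) has_real_derivative
      - \<mu> * (i3 * w3 * p2 / i3 - g * (C - i3 * w3 * g) / i1)) (at t)"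
  proof -
    have "((\<lambda>s. K1 i3 (\<omega> s)) has_real_derivative i3 * \<alpha>3) (at t)"
      unfolding K1_def by (rule DERIV_cmult[OF d3])
    also have "i3 * \<alpha>3 = - \<mu> * (w3 * p2 - g * n)"
      unfolding e3 dot vars by (simp add: p2_def power2_eq_square algebra_simps)
    also have "w3 * p2 - g * n = i3 * w3 * p2 / i3 - g * (C - i3 * w3 * g) / i1"
      using \<open>i3 > 0\<close> n_eq by (simp add: mult.assoc flip: n_eq)
    finally show ?thesis .
  qed

  have Dq': "p2 * (D * q') = p2 * (i3 * w3 * n - a * p2 - \<mu> * q) - i1 * g * (n\<^sup>2 + q\<^sup>2)"
  proof -
    have sq: "n\<^sup>2 + q\<^sup>2 = p2 * (w1\<^sup>2 + w2\<^sup>2)"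
      by (simp add: n_def q_def p2_eq power2_eq_square algebra_simps)
    have "i1 * (x * \<alpha>2 - y * \<alpha>1) = x * (i1 * \<alpha>2) - y * (i1 * \<alpha>1)"
      by (simp add: algebra_simps)
    also have "i1 * \<alpha>2 = - \<mu> * (w2 - (n + w3 * g) * y) - (i1 - i3) * w1 * w3 + (\<sigma> - 1) * a * x"
      using e2 by (simp add: dot vars)
    also have "i1 * \<alpha>1 = - \<mu> * (w1 - (n + w3 * g) * x) - (i3 - i1) * w2 * w3 - (\<sigma> - 1) * a * y"
      using e1 by (simp add: dot vars)
    finally have "i1 * (x * \<alpha>2 - y * \<alpha>1) = - \<mu> * q + (i3 - i1) * w3 * n + (\<sigma> - 1) * a * p2"
      by (simp add: q_def n_def p2_eq power2_eq_square algebra_simps)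
    moreover have "i1 * q' = i1 * (x * \<alpha>2 - y * \<alpha>1) + i1 * w3 * n - i1 * g * (w1\<^sup>2 + w2\<^sup>2)"
      by (simp add: q'_def n_def power2_eq_square algebra_simps)
    ultimately have "D * q' = i3 * w3 * n - a * p2 - \<mu> * q - i1 * g * (w1\<^sup>2 + w2\<^sup>2)"
      by (simp add: D_def sigma power2_eq_square algebra_simps)
    then show ?thesis
      unfolding sq by (simp only:) (simp add: algebra_simps)
  qed

  have d_K2: "((\<lambda>s. K2 i1 a (\<omega> s) (\<gamma> s)) has_real_derivative
      k * ((C - i3 * w3 * g) * (i3 * w3 - C * g) / (i1 * p2\<^sup>2) - a) - \<mu> * (1 / k * q) / D) (at t)"
  proof -
    have dq: "((\<lambda>s. \<gamma> s $ 1 * \<omega> s $ 2 - \<gamma> s $ 2 * \<omega> s $ 1) has_real_derivative q') (at t)"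
      by (rule DERIV_cong, rule DERIV_diff[OF DERIV_mult[OF g1 d2] DERIV_mult[OF g2 d1]])
         (simp add: q'_def vars algebra_simps)
    have dk: "((\<lambda>s. k_factor i1 a (\<gamma> s $ 3)) has_real_derivative - i1 * g * k / (D * p2) * q) (at t)"
      by (rule DERIV_chain2[of _ _ "\<lambda>s. \<gamma> s $ 3"]) (use kf(3) d_gamma3 in \<open>simp_all add: g_def\<close>)
    have "((\<lambda>s. (\<gamma> s $ 1 * \<omega> s $ 2 - \<gamma> s $ 2 * \<omega> s $ 1) / k_factor i1 a (\<gamma> s $ 3)) has_real_derivative
        (q' * k - q * (- i1 * g * k / (D * p2) * q)) / (k * k)) (at t)"
      using DERIV_divide[OF dq dk] k by (simp add: vars k_def[symmetric] q_def[symmetric])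
    also have "(q' * k - q * (- i1 * g * k / (D * p2) * q)) / (k * k)
        = (p2 * (D * q') + i1 * g * q\<^sup>2) / (k * D * p2)"
      using k D p2 by (simp add: divide_simps power2_eq_square) (simp add: algebra_simps)
    also have "p2 * (D * q') + i1 * g * q\<^sup>2 = n * (i3 * w3 * p2 - i1 * n * g) - a * p2\<^sup>2 - \<mu> * q * p2"
      unfolding Dq' by (simp add: power2_eq_square algebra_simps)
    also have "\<dots> / (k * D * p2)
        = k * (n * (i3 * w3 * p2 - i1 * n * g) - a * p2\<^sup>2) / (k\<^sup>2 * D * p2) - \<mu> * (1 / k * q) / D"
      using k D p2 by (simp add: divide_simps power2_eq_square)
    also have "k * (n * (i3 * w3 * p2 - i1 * n * g) - a * p2\<^sup>2) / (k\<^sup>2 * D * p2)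
        = k * (n * (i3 * w3 * p2 - i1 * n * g) / p2\<^sup>2 - a)"
      unfolding k2 using p2 by (simp add: divide_simps power2_eq_square)
    also have "n * (i3 * w3 * p2 - i1 * n * g) / p2\<^sup>2
        = (C - i3 * w3 * g) * (i3 * w3 - C * g) / (i1 * p2\<^sup>2)"
    proof -
      have "i3 * w3 * p2 - i1 * n * g = i3 * w3 - C * g"
        by (simp add: C p2_def power2_eq_square algebra_simps)
      then show ?thesis
        by (simp flip: n_eq)
    qed
    finally show ?thesis
      by (simp add: K2_def)
  qed

  have "((\<lambda>s. reduced_state i1 i3 a (\<omega> s) (\<gamma> s)) has_vector_derivative
      (q, - \<mu> * (i3 * w3 * p2 / i3 - g * (C - i3 * w3 * g) / i1),
       k * ((C - i3 * w3 * g) * (i3 * w3 - C * g) / (i1 * p2\<^sup>2) - a) - \<mu> * (1 / k * q) / D)) (at t)"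
    unfolding reduced_state_def
    by (intro has_vector_derivative_Pair)
       (use d_gamma3 d_K1 d_K2 in \<open>simp_all only: has_real_derivative_iff_has_vector_derivative\<close>)
  also have "(q, - \<mu> * (i3 * w3 * p2 / i3 - g * (C - i3 * w3 * g) / i1),
       k * ((C - i3 * w3 * g) * (i3 * w3 - C * g) / (i1 * p2\<^sup>2) - a) - \<mu> * (1 / k * q) / D)
     = reduced_field i1 i3 a \<mu> C (reduced_state i1 i3 a (\<omega> t) (\<gamma> t))"
  proof -
    have "K2 i1 a (\<omega> t) (\<gamma> t) = 1 / k * q" and "K1 i3 (\<omega> t) = i3 * w3"
      by (simp_all add: K2_def K1_def vars k_def[symmetric] q_def[symmetric])
    moreover have "k * (1 / k * q) = q"
      using k by simp
    ultimately show ?thesis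
      by (simp only: reduced_field_def reduced_state_def prod.case g_def[symmetric] k_def[symmetric]
          p2_def[symmetric] D_def[symmetric])
  qed
  finally show ?thesis
    by (simp add: C_def)
qed

theorem reduced_state_eq_iff:
  assumes "i1 > 0" and "i3 > 0" and "\<gamma> \<bullet> \<gamma> = 1" and "\<gamma>' \<bullet> \<gamma>' = 1" and "\<bar>\<gamma> $ 3\<bar> < 1"
  shows "reduced_state i1 i3 a \<omega> \<gamma> = reduced_state i1 i3 a \<omega>' \<gamma>' \<and>
      area_integral i1 i3 a \<omega> \<gamma> = area_integral i1 i3 a \<omega>' \<gamma>' \<longleftrightarrow>
    (\<exists>\<theta>. \<omega>' = axis_rotation \<theta> \<omega> \<and> \<gamma>' = axis_rotation \<theta> \<gamma>)"
    (is "?L \<longleftrightarrow> ?R")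
proof
  assume ?R
  then obtain \<theta> where w': "\<omega>' = axis_rotation \<theta> \<omega>" and g': "\<gamma>' = axis_rotation \<theta> \<gamma>"
    by blast
  define c s where "c = cos \<theta>" and "s = sin \<theta>"
  have cs: "c * c + s * s = 1"
    using sin_cos_squared_add2[of \<theta>] by (simp add: c_def s_def power2_eq_square)
  have "\<gamma>' $ 1 * \<omega>' $ 2 - \<gamma>' $ 2 * \<omega>' $ 1 = (c * c + s * s) * (\<gamma> $ 1 * \<omega> $ 2 - \<gamma> $ 2 * \<omega> $ 1)"
    and "\<omega>' $ 1 * \<gamma>' $ 1 + \<omega>' $ 2 * \<gamma>' $ 2 = (c * c + s * s) * (\<omega> $ 1 * \<gamma> $ 1 + \<omega> $ 2 * \<gamma> $ 2)"
    and "\<omega>' $ 3 = \<omega> $ 3" and "\<gamma>' $ 3 = \<gamma> $ 3"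
    by (simp_all add: w' g' axis_rotation_def c_def[symmetric] s_def[symmetric] algebra_simps)
  then show ?L
    by (simp add: cs reduced_state_def K1_def K2_def area_integral_coords)
next
  assume L: ?L
  define p2 where "p2 = 1 - (\<gamma> $ 3)\<^sup>2"
  have p2: "p2 > 0"
    using assms(5) by (simp add: p2_def abs_square_less_1)
  have k: "k_factor i1 a (\<gamma> $ 3) > 0"
    using has_real_derivative_k_factor(1)[OF assms(1,5)] .
  have g3: "\<gamma>' $ 3 = \<gamma> $ 3" and w3: "\<omega>' $ 3 = \<omega> $ 3"
    and q: "\<gamma>' $ 1 * \<omega>' $ 2 - \<gamma>' $ 2 * \<omega>' $ 1 = \<gamma> $ 1 * \<omega> $ 2 - \<gamma> $ 2 * \<omega> $ 1"
    using L k \<open>i3 > 0\<close> by (auto simp: reduced_state_def K1_def K2_def)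
  have n: "\<omega>' $ 1 * \<gamma>' $ 1 + \<omega>' $ 2 * \<gamma>' $ 2 = \<omega> $ 1 * \<gamma> $ 1 + \<omega> $ 2 * \<gamma> $ 2"
    using L g3 w3 \<open>i1 > 0\<close> by (auto simp: area_integral_coords)
  have r: "(\<gamma> $ 1)\<^sup>2 + (\<gamma> $ 2)\<^sup>2 = p2" and r': "(\<gamma>' $ 1)\<^sup>2 + (\<gamma>' $ 2)\<^sup>2 = p2"
    using assms(3,4) g3 by (simp_all add: inner_vec_def sum_3 p2_def power2_eq_square)
  define c s where "c = (\<gamma> $ 1 * \<gamma>' $ 1 + \<gamma> $ 2 * \<gamma>' $ 2) / p2"
    and "s = (\<gamma> $ 1 * \<gamma>' $ 2 - \<gamma> $ 2 * \<gamma>' $ 1) / p2"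
  have "(\<gamma> $ 1 * \<gamma>' $ 1 + \<gamma> $ 2 * \<gamma>' $ 2)\<^sup>2 + (\<gamma> $ 1 * \<gamma>' $ 2 - \<gamma> $ 2 * \<gamma>' $ 1)\<^sup>2 = p2 * p2"
    by (subst (1) r[symmetric], subst r'[symmetric]) (simp add: power2_eq_square algebra_simps)
  then have "c\<^sup>2 + s\<^sup>2 = 1"
    using p2 by (simp add: c_def s_def power_divide add_divide_distrib[symmetric])
      (simp add: power2_eq_square)
  then obtain \<theta> where \<theta>: "c = cos \<theta>" "s = sin \<theta>"
    using sincos_total_2pi by metis
  have cp: "p2 * c = \<gamma> $ 1 * \<gamma>' $ 1 + \<gamma> $ 2 * \<gamma>' $ 2" and sp: "p2 * s = \<gamma> $ 1 * \<gamma>' $ 2 - \<gamma> $ 2 * \<gamma>' $ 1"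
    using p2 by (simp_all add: c_def s_def)
  have "p2 * (\<gamma>' $ 1) = p2 * (c * \<gamma> $ 1 - s * \<gamma> $ 2)" "p2 * (\<gamma>' $ 2) = p2 * (s * \<gamma> $ 1 + c * \<gamma> $ 2)"
    using cp sp r by algebra+
  moreover have "p2 * (\<omega>' $ 1) = p2 * (c * \<omega> $ 1 - s * \<omega> $ 2)"
      "p2 * (\<omega>' $ 2) = p2 * (s * \<omega> $ 1 + c * \<omega> $ 2)"
    using cp sp r r' n q by algebra+
  ultimately show ?R
    using p2 g3 w3 by (intro exI[of _ \<theta>])
      (simp add: axis_rotation_def vec_eq_iff forall_3 \<theta>[symmetric])
qed

unbundle no cross3_syntax

end

theory Submission
  imports Defs
begin

unbundle cross3_syntax

text \<open>
  In every permanent rotation the ball turns about the vertical: \<open>\<omega> = c \<gamma>\<close> with a constant \<open>c\<close>. Then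
  neither \<open>\<omega>\<close> nor the rolling resistance torque has a horizontal part, so nothing changes in the axes
  of the ball as soon as the gyroscopic torque \<open>c\<^sup>2 \<gamma> \<times> I\<gamma>\<close> balances the torque \<open>r \<times> \<gamma>\<close> of the plane.
  Both are multiples of \<open>(\<gamma>\<^sub>2, - \<gamma>\<^sub>1, 0)\<close>, so the balance is either vacuous (the axis is vertical:
  the families \<open>\<sigma>\<^sub>u\<close>, \<open>\<sigma>\<^sub>l\<close>) or the equation \<open>c\<^sup>2 (i\<^sub>3 - i\<^sub>1) \<gamma>\<^sub>3 = a\<close> (the family \<open>\<sigma>\<^sub>0\<close>, where
  \<open>c = - c\<^sub>1\<close>). This is \<open>fixed_point_parallel\<close>; the lemma \<open>sigma_0_eq\<close> puts \<open>\<sigma>\<^sub>0\<close> into this form.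

  Conversely, let \<open>\<gamma>\<^sub>3 = g\<close> be constant. If \<open>\<bar>g\<bar> = 1\<close>, the third axis is vertical at all times and
  conservation of the area integral does the rest. If \<open>\<bar>g\<bar> < 1\<close>, the reduced system for
  \<open>(\<gamma>\<^sub>3, K\<^sub>1, K\<^sub>2)\<close> applies: \<open>K\<^sub>2\<close> vanishes identically, and so does its derivative, which is an
  algebraic relation between \<open>K\<^sub>1\<close>, \<open>g\<close> and the constant \<open>C\<close>. This relation is quadratic in \<open>K\<^sub>1\<close>
  and never trivial because \<open>a > 0\<close>; hence \<open>K\<^sub>1\<close>, continuous with at most two values, is constant.
  Only then does the dissipation enter: the equation for \<open>K\<^sub>1\<close> says, since \<open>\<mu> > 0\<close>, that the
  horizontal part of \<open>\<omega>\<close> is zero. The steps are \<open>area_integral_constant\<close>,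
  \<open>permanent_rotation_vertical\<close> and \<open>permanent_rotation_inclined\<close>.
\<close>

section \<open>Rotations about the vertical\<close>

lemma norm_square_coords:
  fixes x :: "real^3"
  shows "x \<bullet> x = (x $ 1)\<^sup>2 + (x $ 2)\<^sup>2 + (x $ 3)\<^sup>2"
  by (simp add: inner_vec_def sum_3 power2_eq_square)

text \<open>
  If the angular velocity is vertical, all terms of the equations of motion vanish except the
  gyroscopic torque and the torque of the plane; the hypothesis is their balance.
\<close>

lemma fixed_point_parallel:
  assumes "\<gamma> \<bullet> \<gamma> = 1"
    and "c\<^sup>2 * (i3 - i1) * \<gamma> $ 3 = a \<or> \<gamma> $ 1 = 0 \<and> \<gamma> $ 2 = 0"
  shows "fixed_point i1 i3 a \<mu> (c *\<^sub>R \<gamma>) \<gamma>"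
proof -
  have "(c *\<^sub>R \<gamma>) \<times> (inertia_tensor i1 i3 *v (c *\<^sub>R \<gamma>))
      = vector [c\<^sup>2 * (i3 - i1) * \<gamma> $ 3 * \<gamma> $ 2, - (c\<^sup>2 * (i3 - i1) * \<gamma> $ 3 * \<gamma> $ 1), 0]"
    by (simp add: inertia_mult cross3_def vec_eq_iff forall_3 power2_eq_square algebra_simps)
  also have "\<dots> = contact_vector a \<gamma> \<times> \<gamma>"
    using assms(2) by (auto simp: contact_cross vec_eq_iff forall_3)
  finally have "(c *\<^sub>R \<gamma>) \<times> (inertia_tensor i1 i3 *v (c *\<^sub>R \<gamma>)) = contact_vector a \<gamma> \<times> \<gamma>" .
  moreover have "(c *\<^sub>R \<gamma>) \<times> \<gamma> = 0"
    by (simp add: cross_mult_left)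
  ultimately show ?thesis
    using assms(1) by (simp add: fixed_point_def rolling_motion_def)
qed

lemma unit_vertical:
  fixes \<gamma> :: "real^3"
  assumes "\<gamma> \<bullet> \<gamma> = 1" and "(\<gamma> $ 3)\<^sup>2 = 1"
  shows "\<gamma> $ 1 = 0" and "\<gamma> $ 2 = 0"
  using assms by (simp_all add: norm_square_coords)

lemma sigma_u_eq:
  assumes "i3 > 0"
  shows "sigma_u i1 i3 a C = {(vector [0, 0, C / i3], vector [0, 0, 1])}"
proof -
  have "\<gamma> \<bullet> \<gamma> = 1 \<and> \<gamma> $ 3 = 1 \<longleftrightarrow> \<gamma> = vector [0, 0, 1]" for \<gamma> :: "real^3"
  proof
    show "\<gamma> = vector [0, 0, 1]" if "\<gamma> \<bullet> \<gamma> = 1 \<and> \<gamma> $ 3 = 1"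
      using that unit_vertical[of \<gamma>] by (simp add: vec_eq_iff forall_3)
  qed (simp add: norm_square_coords)
  moreover have "\<omega> = vector [0, 0, C / i3] \<longleftrightarrow> i3 * \<omega> $ 3 = C \<and> \<omega> $ 1 = 0 \<and> \<omega> $ 2 = 0"
    for \<omega> :: "real^3"
    using assms by (auto simp: vec_eq_iff forall_3 field_simps)
  moreover have "K2 i1 a \<omega> \<gamma> = 0" if "\<omega> $ 1 = 0" "\<omega> $ 2 = 0" for \<omega> \<gamma> :: "real^3"
    using that by (simp add: K2_def)
  ultimately show ?thesis
    unfolding sigma_u_def K1_def by blast
qed

lemma sigma_l_eq:
  assumes "i3 > 0"
  shows "sigma_l i1 i3 a C = {(vector [0, 0, - C / i3], vector [0, 0, - 1])}"
proof -
  have "\<gamma> \<bullet> \<gamma> = 1 \<and> \<gamma> $ 3 = - 1 \<longleftrightarrow> \<gamma> = vector [0, 0, - 1]" for \<gamma> :: "real^3"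
  proof
    show "\<gamma> = vector [0, 0, - 1]" if "\<gamma> \<bullet> \<gamma> = 1 \<and> \<gamma> $ 3 = - 1"
      using that unit_vertical[of \<gamma>] by (simp add: vec_eq_iff forall_3)
  qed (simp add: norm_square_coords)
  moreover have "\<omega> = vector [0, 0, - C / i3] \<longleftrightarrow> i3 * \<omega> $ 3 = - C \<and> \<omega> $ 1 = 0 \<and> \<omega> $ 2 = 0"
    for \<omega> :: "real^3"
    using assms by (auto simp: vec_eq_iff forall_3 field_simps)
  moreover have "K2 i1 a \<omega> \<gamma> = 0" if "\<omega> $ 1 = 0" "\<omega> $ 2 = 0" for \<omega> \<gamma> :: "real^3"
    using that by (simp add: K2_def)
  ultimately show ?thesis
    unfolding sigma_l_def K1_def by blast
qed

text \<open>
  The sign \<open>e\<close> treats the center of mass above and below the geometric center together. For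
  \<open>e = - 1\<close> the vertical and the third axis are opposite, hence the sign of \<open>\<omega>\<^sub>3\<close>.
\<close>

lemma vertical_rotation:
  assumes "i3 > 0" and "e\<^sup>2 = 1"
    and \<omega>: "\<omega> = vector [0, 0, e * C / i3]" and \<gamma>: "\<gamma> = vector [0, 0, e]"
  shows "fixed_point i1 i3 a \<mu> \<omega> \<gamma>" and "area_integral i1 i3 a \<omega> \<gamma> = C"
    and "mass_offset a \<bullet> \<gamma> = a * e"
proof -
  have "\<omega> = (C / i3) *\<^sub>R \<gamma>"
    by (simp add: \<omega> \<gamma> vec_eq_iff forall_3)
  moreover have "\<gamma> \<bullet> \<gamma> = 1"
    using assms(2) by (simp add: \<gamma> norm_square_coords)
  ultimately show "fixed_point i1 i3 a \<mu> \<omega> \<gamma>"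
    using fixed_point_parallel[of \<gamma> "C / i3"] by (simp add: \<gamma>)
  show "area_integral i1 i3 a \<omega> \<gamma> = C"
    using assms(1,2) by (simp add: area_integral_coords \<omega> \<gamma> power2_eq_square)
  show "mass_offset a \<bullet> \<gamma> = a * e"
    by (simp add: mass_offset_def \<gamma> inner_vec_def sum_3)
qed

section \<open>The family with an inclined axis\<close>

text \<open>
  The bound \<open>c\<^sub>0\<close> is the value of \<open>\<bar>c\<^sub>1\<bar>\<close> at which the symmetry axis becomes vertical.
\<close>

lemma sigma0_params_iff:
  assumes "a > 0" and "i1 \<noteq> i3"
  shows "c1 \<in> sigma0_params i1 i3 a \<longleftrightarrow> c1 \<noteq> 0 \<and> \<bar>sigma0_gamma3 i1 i3 a c1\<bar> < 1"
proof -
  define c0 where "c0 = sqrt (a / \<bar>i1 - i3\<bar>)"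
  have c0: "c0 > 0" "c0\<^sup>2 = a / \<bar>i1 - i3\<bar>"
    using assms by (simp_all add: c0_def)
  have "c1 \<in> sigma0_params i1 i3 a \<longleftrightarrow> c0 < \<bar>c1\<bar>"
    using c0(1) by (auto simp: sigma0_params_def Let_def c0_def[symmetric])
  also have "\<dots> \<longleftrightarrow> c0\<^sup>2 < c1\<^sup>2"
    using c0(1) abs_le_square_iff[of c1 c0] by (simp flip: not_le)
  also have "\<dots> \<longleftrightarrow> c1 \<noteq> 0 \<and> \<bar>sigma0_gamma3 i1 i3 a c1\<bar> < 1"
  proof (cases "c1 = 0")
    case False
    have "\<bar>sigma0_gamma3 i1 i3 a c1\<bar> = c0\<^sup>2 / c1\<^sup>2"
      using assms(1) by (simp add: c0(2) sigma0_gamma3_def abs_mult mult.commute)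
    then show ?thesis
      using False by simp
  qed simp
  finally show ?thesis .
qed

text \<open>
  Written through \<open>g = \<gamma>\<^sub>3\<close> instead of \<open>a\<close>, the parametrization is that of a rotation with
  \<open>\<omega> = - c\<^sub>1 \<gamma>\<close>; the first equation is the balance of torques in \<open>fixed_point_parallel\<close>.
\<close>

lemma sigma0_relations:
  assumes "i1 \<noteq> i3" and "c1 \<noteq> 0" and g: "g = sigma0_gamma3 i1 i3 a c1"
  shows "c1\<^sup>2 * (i3 - i1) * g = a"
    and "a / (c1 * (i1 - i3)) = - c1 * g"
    and "sigma0_K1 i1 i3 a c1 = - c1 * i3 * g"
    and "sigma0_C i1 i3 a c1 = - c1 * (i1 * (1 - g\<^sup>2) + i3 * g\<^sup>2)"
proof -
  have d: "i1 - i3 \<noteq> 0" "i3 - i1 \<noteq> 0"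
    using assms(1) by simp_all
  show eq: "c1\<^sup>2 * (i3 - i1) * g = a"
    using d assms(2) by (simp add: g sigma0_gamma3_def divide_simps) (simp add: algebra_simps)
  show w3: "a / (c1 * (i1 - i3)) = - c1 * g"
    using d assms(2) by (simp add: g sigma0_gamma3_def divide_simps power2_eq_square)
  then show "sigma0_K1 i1 i3 a c1 = - c1 * i3 * g"
    by (simp add: sigma0_K1_def mult.commute[of a] flip: times_divide_eq_right) 
  have "a\<^sup>2 / (c1 ^ 3 * (i1 - i3)) = c1 * (i1 - i3) * g\<^sup>2"
    using d assms(2) by (simp add: g sigma0_gamma3_def divide_simps power2_eq_square power3_eq_cube)
  then show "sigma0_C i1 i3 a c1 = - c1 * (i1 * (1 - g\<^sup>2) + i3 * g\<^sup>2)"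
    by (simp add: sigma0_C_def algebra_simps)
qed

lemma sigma_0_eq:
  assumes "i1 \<noteq> i3" and "c1 \<noteq> 0" and "\<bar>sigma0_gamma3 i1 i3 a c1\<bar> < 1"
  shows "sigma_0 i1 i3 a c1 =
    {(\<omega>, \<gamma>). \<gamma> \<bullet> \<gamma> = 1 \<and> \<gamma> $ 3 = sigma0_gamma3 i1 i3 a c1 \<and> \<omega> = - c1 *\<^sub>R \<gamma>}"
proof -
  define g where "g = sigma0_gamma3 i1 i3 a c1"
  define p where "p = sqrt (1 - g\<^sup>2)"
  have p: "p > 0" and p2: "p\<^sup>2 = 1 - g\<^sup>2"
    using assms(3) abs_square_less_1[of g] by (simp_all add: p_def g_def)
  have \<gamma>: "sigma0_gamma i1 i3 a c1 \<phi> = vector [- p * cos \<phi>, - p * sin \<phi>, g]" for \<phi>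
    by (simp add: sigma0_gamma_def Let_def p_def g_def)
  have \<omega>: "sigma0_omega i1 i3 a c1 \<phi> = - c1 *\<^sub>R sigma0_gamma i1 i3 a c1 \<phi>" for \<phi>
    using sigma0_relations(2)[OF assms(1,2) g_def]
    by (simp add: \<gamma> sigma0_omega_def Let_def p_def g_def vec_eq_iff forall_3)
  have "(\<exists>\<phi>. \<gamma> = sigma0_gamma i1 i3 a c1 \<phi>) \<longleftrightarrow> \<gamma> \<bullet> \<gamma> = 1 \<and> \<gamma> $ 3 = g" for \<gamma>
  proof
    assume "\<exists>\<phi>. \<gamma> = sigma0_gamma i1 i3 a c1 \<phi>"
    then obtain \<phi> where "\<gamma> = sigma0_gamma i1 i3 a c1 \<phi>" ..
    moreover have "(p * cos \<phi>)\<^sup>2 + (p * sin \<phi>)\<^sup>2 = p\<^sup>2"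
      by (simp add: power_mult_distrib flip: distrib_left)
    ultimately show "\<gamma> \<bullet> \<gamma> = 1 \<and> \<gamma> $ 3 = g"
      by (simp add: \<gamma> norm_square_coords p2)
  next
    assume *: "\<gamma> \<bullet> \<gamma> = 1 \<and> \<gamma> $ 3 = g"
    then have "(\<gamma> $ 1)\<^sup>2 + (\<gamma> $ 2)\<^sup>2 = p\<^sup>2"
      by (auto simp: norm_square_coords p2)
    then have "(- \<gamma> $ 1 / p)\<^sup>2 + (- \<gamma> $ 2 / p)\<^sup>2 = 1"
      using p by (simp add: power_divide flip: add_divide_distrib)
    then obtain \<phi> where "- \<gamma> $ 1 / p = cos \<phi>" "- \<gamma> $ 2 / p = sin \<phi>"
      using sincos_total_2pi by metis
    then have "\<gamma> $ 1 = - p * cos \<phi>" "\<gamma> $ 2 = - p * sin \<phi>"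
      using p by (simp_all add: field_simps)
    then have "\<gamma> = sigma0_gamma i1 i3 a c1 \<phi>"
      using * by (simp add: \<gamma> vec_eq_iff forall_3)
    then show "\<exists>\<phi>. \<gamma> = sigma0_gamma i1 i3 a c1 \<phi>" ..
  qed
  then show ?thesis
    unfolding sigma_0_def \<omega> g_def set_eq_iff mem_Collect_eq split_paired_All prod.case prod.inject
    by metis
qed

text \<open>
  For a given \<open>\<gamma>\<close> that is not vertical the three equations determine \<open>\<omega>\<close>: \<open>K\<^sub>1\<close> gives its third
  component, \<open>K\<^sub>2 = 0\<close> makes \<open>(\<omega>\<^sub>1, \<omega>\<^sub>2)\<close> proportional to \<open>(\<gamma>\<^sub>1, \<gamma>\<^sub>2)\<close>, and the area integral gives
  the factor.
\<close>

lemma sigma_0_level_set: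
  assumes "i1 > 0" and "i3 > 0" and "i1 \<noteq> i3" and "c1 \<noteq> 0" and "\<bar>sigma0_gamma3 i1 i3 a c1\<bar> < 1"
  shows "sigma_0 i1 i3 a c1 =
    {(\<omega>, \<gamma>). \<gamma> \<bullet> \<gamma> = 1 \<and> \<gamma> $ 3 = sigma0_gamma3 i1 i3 a c1 \<and> K1 i3 \<omega> = sigma0_K1 i1 i3 a c1 \<and>
       K2 i1 a \<omega> \<gamma> = 0 \<and> area_integral i1 i3 a \<omega> \<gamma> = sigma0_C i1 i3 a c1}"
proof -
  define g where "g = sigma0_gamma3 i1 i3 a c1"
  note rel = sigma0_relations[OF assms(3,4) g_def]
  have k: "k_factor i1 a g > 0"
    using has_real_derivative_k_factor(1) assms(1,5) by (simp add: g_def)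
  have p2: "1 - g\<^sup>2 > 0"
    using assms(5) by (simp add: g_def abs_square_less_1)
  have "\<omega> = - c1 *\<^sub>R \<gamma> \<longleftrightarrow> K1 i3 \<omega> = sigma0_K1 i1 i3 a c1 \<and>
       K2 i1 a \<omega> \<gamma> = 0 \<and> area_integral i1 i3 a \<omega> \<gamma> = sigma0_C i1 i3 a c1"
    if unit: "\<gamma> \<bullet> \<gamma> = 1" and \<gamma>3: "\<gamma> $ 3 = g" for \<omega> \<gamma>
  proof -
    have r: "(\<gamma> $ 1)\<^sup>2 + (\<gamma> $ 2)\<^sup>2 = 1 - g\<^sup>2"
      using unit \<gamma>3 by (simp add: norm_square_coords)
    define n q where "n = \<omega> $ 1 * \<gamma> $ 1 + \<omega> $ 2 * \<gamma> $ 2" and "q = \<gamma> $ 1 * \<omega> $ 2 - \<gamma> $ 2 * \<omega> $ 1"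
    have "K1 i3 \<omega> - sigma0_K1 i1 i3 a c1 = i3 * (\<omega> $ 3 - - c1 * g)"
      by (simp add: K1_def rel(3) algebra_simps)
    then have "K1 i3 \<omega> = sigma0_K1 i1 i3 a c1 \<longleftrightarrow> \<omega> $ 3 = - c1 * g"
      using assms(2) by (metis eq_iff_diff_eq_0 mult_eq_0_iff less_irrefl)
    moreover have "K2 i1 a \<omega> \<gamma> = 0 \<longleftrightarrow> q = 0"
      using k by (simp add: K2_def \<gamma>3 q_def)
    moreover have "area_integral i1 i3 a \<omega> \<gamma> = sigma0_C i1 i3 a c1 \<longleftrightarrow> n = - c1 * (1 - g\<^sup>2)"
      if "\<omega> $ 3 = - c1 * g"
    proof -
      have "area_integral i1 i3 a \<omega> \<gamma> - sigma0_C i1 i3 a c1 = i1 * (n - - c1 * (1 - g\<^sup>2))"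
        by (simp add: area_integral_coords rel(4) that \<gamma>3 n_def power2_eq_square algebra_simps)
      then show ?thesis
        using assms(1) by (metis eq_iff_diff_eq_0 mult_eq_0_iff less_irrefl)
    qed
    moreover have "q = 0 \<and> n = - c1 * (1 - g\<^sup>2) \<longleftrightarrow> \<omega> $ 1 = - c1 * \<gamma> $ 1 \<and> \<omega> $ 2 = - c1 * \<gamma> $ 2"
    proof
      assume "q = 0 \<and> n = - c1 * (1 - g\<^sup>2)"
      then have "(1 - g\<^sup>2) * \<omega> $ 1 = (1 - g\<^sup>2) * (- c1 * \<gamma> $ 1)"
          "(1 - g\<^sup>2) * \<omega> $ 2 = (1 - g\<^sup>2) * (- c1 * \<gamma> $ 2)"
        using r unfolding n_def q_def by algebra+
      then show "\<omega> $ 1 = - c1 * \<gamma> $ 1 \<and> \<omega> $ 2 = - c1 * \<gamma> $ 2"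
        using p2 by (metis mult_left_cancel less_irrefl)
    next
      assume "\<omega> $ 1 = - c1 * \<gamma> $ 1 \<and> \<omega> $ 2 = - c1 * \<gamma> $ 2"
      then show "q = 0 \<and> n = - c1 * (1 - g\<^sup>2)"
        unfolding r[symmetric] by (simp add: n_def q_def power2_eq_square algebra_simps)
    qed
    ultimately show ?thesis
      by (auto simp: vec_eq_iff forall_3 \<gamma>3)
  qed
  then show ?thesis
    unfolding sigma_0_eq[OF assms(3-5)] g_def by blast
qed

lemma sigma_0_reduced_fixed_point:
  assumes "i1 > 0" and "i3 > 0" and "i1 \<noteq> i3" and "c1 \<noteq> 0" and "\<bar>sigma0_gamma3 i1 i3 a c1\<bar> < 1"
  shows "reduced_fixed_point i1 i3 a \<mu> (sigma0_C i1 i3 a c1)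
    (sigma0_gamma3 i1 i3 a c1, sigma0_K1 i1 i3 a c1, 0)"
proof -
  define g where "g = sigma0_gamma3 i1 i3 a c1"
  define p2 where "p2 = 1 - g\<^sup>2"
  note rel = sigma0_relations[OF assms(3,4) g_def]
  have p2: "p2 > 0"
    using assms(5) by (simp add: p2_def g_def abs_square_less_1)
  have n: "sigma0_C i1 i3 a c1 - sigma0_K1 i1 i3 a c1 * g = - c1 * i1 * p2"
    by (simp add: rel(3,4) p2_def power2_eq_square algebra_simps)
  have m: "sigma0_K1 i1 i3 a c1 - sigma0_C i1 i3 a c1 * g = - c1 * (i3 - i1) * g * p2"
    by (simp add: rel(3,4) p2_def power2_eq_square algebra_simps)
  have "- c1 * i1 * p2 * (- c1 * (i3 - i1) * g * p2) / (i1 * p2\<^sup>2) = c1\<^sup>2 * (i3 - i1) * g"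
    using assms(1) p2 by (simp add: power2_eq_square)
  also have "\<dots> = a"
    by (rule rel(1))
  finally have "(sigma0_C i1 i3 a c1 - sigma0_K1 i1 i3 a c1 * g) *
      (sigma0_K1 i1 i3 a c1 - sigma0_C i1 i3 a c1 * g) / (i1 * (1 - g\<^sup>2)\<^sup>2) = a"
    by (simp only: n m p2_def[symmetric])
  moreover have "sigma0_K1 i1 i3 a c1 * (1 - g\<^sup>2) / i3
      = g * (sigma0_C i1 i3 a c1 - sigma0_K1 i1 i3 a c1 * g) / i1"
    unfolding n using assms(1,2) by (simp add: rel(3) p2_def)
  ultimately show ?thesis
    using assms(5) by (simp add: reduced_fixed_point_def reduced_field_def zero_prod_def g_def[symmetric])
qed

lemma inclination_unit:
  assumes "\<gamma> \<bullet> \<gamma> = 1"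
  shows "inclination \<gamma> = arccos (\<gamma> $ 3)"
proof -
  have "norm \<gamma> = 1"
    using assms by (simp add: norm_eq_1)
  then show ?thesis
    by (simp add: inclination_def inner_axis')
qed

lemma sigma_0_inclination:
  assumes "i1 \<noteq> i3" and "c1 \<noteq> 0" and "\<bar>sigma0_gamma3 i1 i3 a c1\<bar> < 1"
    and "(\<omega>, \<gamma>) \<in> sigma_0 i1 i3 a c1"
  shows "inclination \<gamma> = arccos (sigma0_gamma3 i1 i3 a c1)" and "inclination \<gamma> \<in> {0<..<pi}"
  using assms(3,4) arccos_lt_bounded by (auto simp: sigma_0_eq[OF assms(1-3)] inclination_unit)

lemma sigma_0_fixed_point:
  assumes "i1 \<noteq> i3" and "c1 \<noteq> 0" and "\<bar>sigma0_gamma3 i1 i3 a c1\<bar> < 1"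
    and "(\<omega>, \<gamma>) \<in> sigma_0 i1 i3 a c1"
  shows "fixed_point i1 i3 a \<mu> \<omega> \<gamma>"
  using assms(4) fixed_point_parallel[of \<gamma> "- c1"] sigma0_relations(1)[OF assms(1,2) refl]
  by (simp add: sigma_0_eq[OF assms(1-3)])

text \<open>
  In the axes of the ball the vertical moves by \<open>- \<omega> \<times> \<gamma>\<close>, which is zero here. The periodicity of
  the motions in \<open>\<sigma>\<^sub>0\<close> is therefore that of a constant function, with every number as a period: the
  turning of the ball about the vertical is visible only in axes fixed in space.
\<close>

lemma parallel_motion_constant:
  assumes "rolling_motion i1 i3 a \<mu> UNIV \<omega> \<gamma>" and parallel: "\<And>t. \<omega> t = c *\<^sub>R \<gamma> t"
  shows "\<omega> t = \<omega> 0 \<and> \<gamma> t = \<gamma> 0"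
proof -
  have "(\<gamma> has_vector_derivative 0) (at s)" for s
  proof -
    have "\<gamma> differentiable (at s)" "vector_derivative \<gamma> (at s) + \<omega> s \<times> \<gamma> s = 0"
      using assms(1) by (auto simp: rolling_motion_def)
    then show ?thesis
      by (simp add: parallel cross_mult_left vector_derivative_works)
  qed
  then obtain v where "\<And>s. s \<in> UNIV \<Longrightarrow> \<gamma> s = v"
    using has_vector_derivative_zero_constant[OF convex_UNIV] by blast
  then show ?thesis
    by (simp add: parallel)
qed

lemma sigma_0_periodic:
  assumes "i1 \<noteq> i3" and "c1 \<noteq> 0" and "\<bar>sigma0_gamma3 i1 i3 a c1\<bar> < 1"
    and "rolling_motion i1 i3 a \<mu> UNIV \<omega> \<gamma>" and "\<And>t. (\<omega> t, \<gamma> t) \<in> sigma_0 i1 i3 a c1"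
  shows "periodic_fun_simple (\<lambda>t. (\<omega> t, \<gamma> t)) P"
proof -
  have "\<omega> t = \<omega> 0 \<and> \<gamma> t = \<gamma> 0" for t
    by (rule parallel_motion_constant[OF assms(4), of "- c1"])
      (use assms(5) in \<open>auto simp: sigma_0_eq[OF assms(1-3)]\<close>)
  then show ?thesis
    by unfold_locales metis
qed

section \<open>Permanent rotations\<close>

lemma rolling_motion_zero_derivative_constant:
  fixes f :: "real \<Rightarrow> real"
  assumes "rolling_motion i1 i3 a \<mu> T \<omega> \<gamma>" and "\<And>t. t \<in> T \<Longrightarrow> (f has_real_derivative 0) (at t)"
  shows "f constant_on T"
proof -
  have "convex T"
    using assms(1) by (simp add: rolling_motion_def is_interval_convex)
  moreover have "(f has_real_derivative 0) (at t within T)" if "t \<in> T" for t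
    using assms(2)[OF that] by (rule has_field_derivative_at_within)
  ultimately show ?thesis
    using has_field_derivative_zero_constant[of T f] unfolding constant_on_def by blast
qed

lemma constant_on_zero_derivative:
  fixes f :: "real \<Rightarrow> real"
  assumes "open T" and "t \<in> T" and "f constant_on T"
  shows "(f has_real_derivative 0) (at t)"
proof -
  obtain y where y: "\<And>s. s \<in> T \<Longrightarrow> f s = y"
    using assms(3) by (auto simp: constant_on_def)
  show ?thesis
    by (rule has_field_derivative_transform_within_open[OF DERIV_const[of y] assms(1,2)]) (simp add: y)
qed

lemma permanent_rotation_iff:
  assumes motion: "rolling_motion i1 i3 a \<mu> T \<omega> \<gamma>"
  shows "permanent_rotation i1 i3 a \<mu> T \<omega> \<gamma> \<longleftrightarrow>
    (\<forall>t\<in>T. ((\<lambda>s. \<gamma> s $ 3) has_real_derivative 0) (at t) \<and>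
           (deriv (\<lambda>s. \<gamma> s $ 3) has_real_derivative 0) (at t))"
proof -
  have "open T"
    using motion by (simp add: rolling_motion_def)
  note zero = constant_on_zero_derivative[OF this]
  have "deriv f constant_on T" if "f constant_on T" for f :: "real \<Rightarrow> real"
    unfolding constant_on_def by (meson DERIV_imp_deriv zero that)
  then show ?thesis
    using motion zero rolling_motion_zero_derivative_constant[OF motion]
    unfolding permanent_rotation_def by meson
qed

text \<open>
  The area integral is the vertical component of the angular momentum; the torques of the plane,
  along \<open>r \<times> \<gamma>\<close>, and of the rolling resistance are both horizontal.
\<close>

lemma area_integral_constant:
  assumes motion: "rolling_motion i1 i3 a \<mu> T \<omega> \<gamma>"
  shows "(\<lambda>t. area_integral i1 i3 a (\<omega> t) (\<gamma> t)) constant_on T"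
proof (rule rolling_motion_zero_derivative_constant[OF motion])
  fix t assume "t \<in> T"
  with motion obtain \<alpha>1 \<alpha>2 \<alpha>3 \<sigma> where
    d: "((\<lambda>s. \<omega> s $ 1) has_real_derivative \<alpha>1) (at t)"
      "((\<lambda>s. \<omega> s $ 2) has_real_derivative \<alpha>2) (at t)"
      "((\<lambda>s. \<omega> s $ 3) has_real_derivative \<alpha>3) (at t)"
      "((\<lambda>s. \<gamma> s $ 1) has_real_derivative \<omega> t $ 3 * \<gamma> t $ 2 - \<omega> t $ 2 * \<gamma> t $ 3) (at t)"
      "((\<lambda>s. \<gamma> s $ 2) has_real_derivative \<omega> t $ 1 * \<gamma> t $ 3 - \<omega> t $ 3 * \<gamma> t $ 1) (at t)"
      "((\<lambda>s. \<gamma> s $ 3) has_real_derivative \<gamma> t $ 1 * \<omega> t $ 2 - \<gamma> t $ 2 * \<omega> t $ 1) (at t)" and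
    unit: "(\<gamma> t $ 1)\<^sup>2 + (\<gamma> t $ 2)\<^sup>2 + (\<gamma> t $ 3)\<^sup>2 = 1" and
    e: "i1 * \<alpha>1 + (i3 - i1) * \<omega> t $ 2 * \<omega> t $ 3 + (\<sigma> - 1) * a * \<gamma> t $ 2
       = - \<mu> * (\<omega> t $ 1 - (\<omega> t \<bullet> \<gamma> t) * \<gamma> t $ 1)"
      "i1 * \<alpha>2 + (i1 - i3) * \<omega> t $ 1 * \<omega> t $ 3 - (\<sigma> - 1) * a * \<gamma> t $ 1
       = - \<mu> * (\<omega> t $ 2 - (\<omega> t \<bullet> \<gamma> t) * \<gamma> t $ 2)"
      "i3 * \<alpha>3 = - \<mu> * (\<omega> t $ 3 - (\<omega> t \<bullet> \<gamma> t) * \<gamma> t $ 3)"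
    by (rule rolling_motion_coords)
  have dot: "\<omega> t \<bullet> \<gamma> t = \<omega> t $ 1 * \<gamma> t $ 1 + \<omega> t $ 2 * \<gamma> t $ 2 + \<omega> t $ 3 * \<gamma> t $ 3"
    by (simp add: inner_vec_def sum_3)
  have zero: "i1 * (\<alpha>1 * \<gamma> t $ 1 + (\<omega> t $ 3 * \<gamma> t $ 2 - \<omega> t $ 2 * \<gamma> t $ 3) * \<omega> t $ 1
        + (\<alpha>2 * \<gamma> t $ 2 + (\<omega> t $ 1 * \<gamma> t $ 3 - \<omega> t $ 3 * \<gamma> t $ 1) * \<omega> t $ 2))
      + i3 * (\<alpha>3 * \<gamma> t $ 3 + (\<gamma> t $ 1 * \<omega> t $ 2 - \<gamma> t $ 2 * \<omega> t $ 1) * \<omega> t $ 3) = 0"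
    using unit e dot by algebra
  have "((\<lambda>s. i1 * (\<omega> s $ 1 * \<gamma> s $ 1 + \<omega> s $ 2 * \<gamma> s $ 2) + i3 * (\<omega> s $ 3 * \<gamma> s $ 3))
      has_real_derivative 0) (at t)"
    by (rule DERIV_cong[OF DERIV_add[OF DERIV_cmult[OF DERIV_add[OF DERIV_mult[OF d(1,4)]
          DERIV_mult[OF d(2,5)]]] DERIV_cmult[OF DERIV_mult[OF d(3,6)]]] zero])
  then show "((\<lambda>t. area_integral i1 i3 a (\<omega> t) (\<gamma> t)) has_real_derivative 0) (at t)"
    by (simp add: area_integral_coords mult.assoc)
qed

text \<open>
  Here \<open>k = 0\<close> and the reduced variables degenerate, but \<open>\<gamma>\<close> itself is constant, so that \<open>\<omega>\<close> is
  vertical; its length follows from the area integral.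
\<close>

lemma permanent_rotation_vertical:
  assumes "i3 > 0" and perm: "permanent_rotation i1 i3 a \<mu> T \<omega> \<gamma>"
    and vertical: "\<And>t. t \<in> T \<Longrightarrow> \<gamma> t $ 3 = e" and e: "e = 1 \<or> e = - 1"
  shows "\<exists>C. \<forall>t\<in>T. (\<omega> t, \<gamma> t) \<in> (if e = 1 then sigma_u i1 i3 a C else sigma_l i1 i3 a C)"
proof -
  have motion: "rolling_motion i1 i3 a \<mu> T \<omega> \<gamma>"
    using perm by (simp add: permanent_rotation_def)
  then have "open T"
    by (simp add: rolling_motion_def)
  obtain C where C: "\<And>t. t \<in> T \<Longrightarrow> area_integral i1 i3 a (\<omega> t) (\<gamma> t) = C"
    using area_integral_constant[OF motion] by (auto simp: constant_on_def)
  have e2: "e * e = 1"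
    using e by auto
  have "\<gamma> t \<bullet> \<gamma> t = 1 \<and> \<omega> t $ 1 = 0 \<and> \<omega> t $ 2 = 0 \<and> K1 i3 (\<omega> t) = e * C \<and> K2 i1 a (\<omega> t) (\<gamma> t) = 0"
    if t: "t \<in> T" for t
  proof -
    have unit: "\<gamma> s \<bullet> \<gamma> s = 1" if "s \<in> T" for s
      using motion that by (simp add: rolling_motion_def)
    have \<gamma>0: "\<gamma> s $ 1 = 0" "\<gamma> s $ 2 = 0" if "s \<in> T" for s
      using unit_vertical[OF unit[OF that]] vertical[OF that] e2 by (simp_all add: power2_eq_square)
    have "((\<lambda>s. \<gamma> s $ 1) has_real_derivative 0) (at t)" "((\<lambda>s. \<gamma> s $ 2) has_real_derivative 0) (at t)"
      by (auto intro!: constant_on_zero_derivative[OF \<open>open T\<close> t] simp: constant_on_def \<gamma>0)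
    moreover obtain
      "((\<lambda>s. \<gamma> s $ 1) has_real_derivative \<omega> t $ 3 * \<gamma> t $ 2 - \<omega> t $ 2 * \<gamma> t $ 3) (at t)"
      "((\<lambda>s. \<gamma> s $ 2) has_real_derivative \<omega> t $ 1 * \<gamma> t $ 3 - \<omega> t $ 3 * \<gamma> t $ 1) (at t)"
      by (rule rolling_motion_coords[OF motion t])
    ultimately have "\<omega> t $ 3 * \<gamma> t $ 2 - \<omega> t $ 2 * \<gamma> t $ 3 = 0" "\<omega> t $ 1 * \<gamma> t $ 3 - \<omega> t $ 3 * \<gamma> t $ 1 = 0"
      by (auto dest: DERIV_unique)
    then have \<omega>0: "\<omega> t $ 1 = 0" "\<omega> t $ 2 = 0"
      using \<gamma>0[OF t] vertical[OF t] e by auto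
    have "K1 i3 (\<omega> t) * e = C"
      using C[OF t] by (simp add: area_integral_coords \<gamma>0[OF t] vertical[OF t] K1_def)
    then have "K1 i3 (\<omega> t) = e * C"
      using e by auto
    then show ?thesis
      using unit[OF t] \<omega>0 by (simp add: K2_def)
  qed
  then show ?thesis
    using vertical e by (intro exI[of _ C]) (auto simp: sigma_u_def sigma_l_def)
qed

text \<open>
  The parameter \<open>c\<^sub>1\<close> is recovered from the horizontal part of the area integral,
  \<open>C - K\<^sub>1 g = - c\<^sub>1 i\<^sub>1 (1 - g\<^sup>2)\<close>, which is how \<open>c\<^sub>1\<close> enters \<open>\<sigma>\<^sub>0\<close>.
\<close>

lemma permanent_rotation_inclined:
  assumes "a > 0" and "i1 > 0" and "i3 > 0" and "\<mu> > 0"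
    and perm: "permanent_rotation i1 i3 a \<mu> T \<omega> \<gamma>"
    and inclined: "\<And>t. t \<in> T \<Longrightarrow> \<gamma> t $ 3 = g" and g: "\<bar>g\<bar> < 1"
  shows "i1 \<noteq> i3 \<and> (\<exists>c1 \<in> sigma0_params i1 i3 a. \<forall>t\<in>T. (\<omega> t, \<gamma> t) \<in> sigma_0 i1 i3 a c1)"
proof -
  have motion: "rolling_motion i1 i3 a \<mu> T \<omega> \<gamma>"
    using perm by (simp add: permanent_rotation_def)
  then have T: "open T" "connected T" "T \<noteq> {}"
    by (auto simp: rolling_motion_def is_interval_connected)
  obtain C where C: "\<And>t. t \<in> T \<Longrightarrow> area_integral i1 i3 a (\<omega> t) (\<gamma> t) = C"
    using area_integral_constant[OF motion] by (auto simp: constant_on_def)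
  define \<kappa> where "\<kappa> t = K1 i3 (\<omega> t)" for t
  define k where "k = k_factor i1 a g"
  define p2 where "p2 = 1 - g\<^sup>2"
  have k: "k > 0"
    using has_real_derivative_k_factor(1)[OF \<open>i1 > 0\<close> g] by (simp add: k_def)
  have p2: "p2 > 0"
    using g by (simp add: p2_def abs_square_less_1)
  have field: "((\<lambda>s. (\<gamma> s $ 3, \<kappa> s, K2 i1 a (\<omega> s) (\<gamma> s))) has_vector_derivative
      reduced_field i1 i3 a \<mu> C (g, \<kappa> t, K2 i1 a (\<omega> t) (\<gamma> t))) (at t)" if "t \<in> T" for t
    using reduced_system[OF \<open>i1 > 0\<close> \<open>i3 > 0\<close> motion that] inclined[OF that] C[OF that] g
    by (simp add: reduced_state_def \<kappa>_def)
  have d\<gamma>3: "((\<lambda>s. \<gamma> s $ 3) has_real_derivative k * K2 i1 a (\<omega> t) (\<gamma> t)) (at t)"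
    and d\<kappa>: "(\<kappa> has_real_derivative - \<mu> * (\<kappa> t * p2 / i3 - g * (C - \<kappa> t * g) / i1)) (at t)"
    and dK2: "((\<lambda>s. K2 i1 a (\<omega> s) (\<gamma> s)) has_real_derivative
       k * ((C - \<kappa> t * g) * (\<kappa> t - C * g) / (i1 * p2\<^sup>2) - a)
         - \<mu> * K2 i1 a (\<omega> t) (\<gamma> t) / (i1 + a\<^sup>2 * p2)) (at t)" if "t \<in> T" for t
    using bounded_linear.has_vector_derivative[OF bounded_linear_fst field[OF that]]
      bounded_linear.has_vector_derivative[OF bounded_linear_compose[OF bounded_linear_fst bounded_linear_snd] field[OF that]]
      bounded_linear.has_vector_derivative[OF bounded_linear_compose[OF bounded_linear_snd bounded_linear_snd] field[OF that]]
    by (simp_all add: reduced_field_def k_def p2_def has_real_derivative_iff_has_vector_derivative)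
  have K2: "K2 i1 a (\<omega> t) (\<gamma> t) = 0" if "t \<in> T" for t
  proof -
    have "((\<lambda>s. \<gamma> s $ 3) has_real_derivative 0) (at t)"
      by (rule constant_on_zero_derivative[OF T(1) that]) (auto simp: constant_on_def inclined)
    then have "k * K2 i1 a (\<omega> t) (\<gamma> t) = 0"
      by (rule DERIV_unique[OF d\<gamma>3[OF that]])
    then show ?thesis
      using k by simp
  qed
  have balance: "(C - \<kappa> t * g) * (\<kappa> t - C * g) = a * i1 * p2\<^sup>2" if "t \<in> T" for t
  proof -
    have "((\<lambda>s. K2 i1 a (\<omega> s) (\<gamma> s)) has_real_derivative 0) (at t)"
      by (rule constant_on_zero_derivative[OF T(1) that]) (auto simp: constant_on_def K2)
    from DERIV_unique[OF dK2[OF that] this]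
    have "(C - \<kappa> t * g) * (\<kappa> t - C * g) / (i1 * p2\<^sup>2) = a"
      using k by (simp add: K2[OF that])
    then show ?thesis
      using \<open>i1 > 0\<close> p2 by (auto simp: field_simps)
  qed

  have "\<kappa> constant_on T"
  proof (rule continuous_finite_range_constant[OF T(2)])
    show "continuous_on T \<kappa>"
      using d\<kappa> by (meson DERIV_isCont continuous_at_imp_continuous_on)
    define Q where "Q = [:- C\<^sup>2 * g - a * i1 * p2\<^sup>2, C * (1 + g\<^sup>2), - g:]"
    \<comment> \<open>The coefficients of degree 2 and 1 vanish only if \<open>g = C = 0\<close>; then the constant one does not.\<close>
    have "Q \<noteq> 0"
    proof
      assume "Q = 0"
      then have "g = 0" "C = 0" "a * i1 * p2\<^sup>2 = 0"
        by (auto simp: Q_def split: if_splits)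
      then show False
        using assms(1,2) p2 by simp
    qed
    moreover have "\<kappa> ` T \<subseteq> {x. poly Q x = 0}"
      using balance by (auto simp: Q_def power2_eq_square algebra_simps)
    ultimately show "finite (\<kappa> ` T)"
      using poly_roots_finite finite_subset by blast
  qed
  then obtain K where K: "\<And>t. t \<in> T \<Longrightarrow> \<kappa> t = K"
    by (auto simp: constant_on_def)
  obtain t0 where t0: "t0 \<in> T"
    using T(3) by blast
  define c1 where "c1 = - (C - K * g) / (i1 * p2)"
  have n: "C - K * g = - c1 * i1 * p2"
    using assms(2) p2 by (simp add: c1_def)
  \<comment> \<open>The rolling resistance has to vanish, as \<open>K\<^sub>1\<close> does not change.\<close>
  have "K * p2 / i3 - g * (C - K * g) / i1 = 0"
    using DERIV_unique[OF d\<kappa>[OF t0] constant_on_zero_derivative[OF T(1) t0 \<open>\<kappa> constant_on T\<close>]]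
      \<open>\<mu> > 0\<close> by (simp add: K[OF t0])
  then have "p2 * K = p2 * (- c1 * i3 * g)"
    unfolding n using assms(2,3) by (simp add: field_simps)
  then have K_eq: "K = - c1 * i3 * g"
    using p2 by (metis mult_left_cancel less_irrefl)
  have C_eq: "C = - c1 * (i1 * (1 - g\<^sup>2) + i3 * g\<^sup>2)"
    using n by (simp add: K_eq p2_def power2_eq_square algebra_simps)
  have "(i1 * p2\<^sup>2) * (c1\<^sup>2 * (i3 - i1) * g) = (i1 * p2\<^sup>2) * a"
    using balance[OF t0] unfolding K[OF t0] n
    by (simp add: K_eq C_eq p2_def power2_eq_square algebra_simps)
  then have c1: "c1\<^sup>2 * (i3 - i1) * g = a"
    using assms(2) p2 by (metis mult_left_cancel less_irrefl mult_eq_0_iff power_not_zero)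
  then have ne: "i1 \<noteq> i3" "c1 \<noteq> 0"
    using \<open>a > 0\<close> by auto
  have \<gamma>3: "sigma0_gamma3 i1 i3 a c1 = g"
    using ne by (simp add: sigma0_gamma3_def flip: c1) (simp add: field_simps)
  note rel = sigma0_relations[OF ne \<gamma>3[symmetric]]
  have "c1 \<in> sigma0_params i1 i3 a"
    using sigma0_params_iff[OF \<open>a > 0\<close> ne(1)] ne(2) g by (simp add: \<gamma>3)
  moreover have "(\<omega> t, \<gamma> t) \<in> sigma_0 i1 i3 a c1" if "t \<in> T" for t
  proof -
    have "\<gamma> t \<bullet> \<gamma> t = 1"
      using motion that by (simp add: rolling_motion_def)
    moreover have "\<bar>sigma0_gamma3 i1 i3 a c1\<bar> < 1"
      using g by (simp add: \<gamma>3)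
    ultimately show ?thesis
      using C[OF that] K2[OF that] K[OF that] inclined[OF that]
      by (simp add: sigma_0_level_set[OF assms(2,3) ne] \<gamma>3 rel(3,4) \<kappa>_def K_eq C_eq)
  qed
  ultimately show ?thesis
    using ne(1) by blast
qed

lemma permanent_rotation_classification:
  assumes "a > 0" and "i1 > 0" and "i3 > 0" and "\<mu> > 0"
    and perm: "permanent_rotation i1 i3 a \<mu> T \<omega> \<gamma>"
  shows "(\<exists>C. \<forall>t\<in>T. (\<omega> t, \<gamma> t) \<in> sigma_u i1 i3 a C) \<or>
    (\<exists>C. \<forall>t\<in>T. (\<omega> t, \<gamma> t) \<in> sigma_l i1 i3 a C) \<or>
    (i1 \<noteq> i3 \<and> (\<exists>c1 \<in> sigma0_params i1 i3 a. \<forall>t\<in>T. (\<omega> t, \<gamma> t) \<in> sigma_0 i1 i3 a c1))"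
proof -
  obtain g where g: "\<And>t. t \<in> T \<Longrightarrow> \<gamma> t $ 3 = g"
    using perm by (auto simp: permanent_rotation_def constant_on_def)
  obtain t where "t \<in> T" "\<gamma> t \<bullet> \<gamma> t = 1"
    using perm by (auto simp: permanent_rotation_def rolling_motion_def)
  then have "(\<gamma> t $ 1)\<^sup>2 + (\<gamma> t $ 2)\<^sup>2 + g\<^sup>2 = 1"
    using g[of t] by (simp add: norm_square_coords)
  then have "g\<^sup>2 \<le> 1"
    using sum_power2_ge_zero[of "\<gamma> t $ 1" "\<gamma> t $ 2"] by linarith
  then consider "g = 1" | "g = - 1" | "\<bar>g\<bar> < 1"
    unfolding abs_square_le_1 by linarith
  then show ?thesis
    using permanent_rotation_vertical[OF assms(3) perm g] permanent_rotation_inclined[OF assms g]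
    by cases auto
qed

unbundle no cross3_syntax

theorem mainTheorem2:
  fixes a i1 i3 \<mu> :: real
  assumes "a > 0" and "i1 > 0" and "i3 > 0" and "\<mu> > 0"
  shows
    "(\<forall>T \<omega> \<gamma>. rolling_motion i1 i3 a \<mu> T \<omega> \<gamma> \<longrightarrow>
        (permanent_rotation i1 i3 a \<mu> T \<omega> \<gamma> \<longleftrightarrow>
          (\<forall>t\<in>T. ((\<lambda>s. \<gamma> s $ 3) has_real_derivative 0) (at t) \<and>
                 (deriv (\<lambda>s. \<gamma> s $ 3) has_real_derivative 0) (at t)))) \<and>
     (\<forall>C.
        sigma_u i1 i3 a C = {(vector [0, 0, C / i3], vector [0, 0, 1])} \<and>
        sigma_l i1 i3 a C = {(vector [0, 0, - C / i3], vector [0, 0, - 1])} \<and>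
        (\<forall>(\<omega>, \<gamma>) \<in> sigma_u i1 i3 a C.
           fixed_point i1 i3 a \<mu> \<omega> \<gamma> \<and> area_integral i1 i3 a \<omega> \<gamma> = C \<and> mass_offset a \<bullet> \<gamma> > 0) \<and>
        (\<forall>(\<omega>, \<gamma>) \<in> sigma_l i1 i3 a C.
           fixed_point i1 i3 a \<mu> \<omega> \<gamma> \<and> area_integral i1 i3 a \<omega> \<gamma> = C \<and> mass_offset a \<bullet> \<gamma> < 0)) \<and>
     (i1 \<noteq> i3 \<longrightarrow> (\<forall>c1 \<in> sigma0_params i1 i3 a.
        sigma_0 i1 i3 a c1 =
          {(\<omega>, \<gamma>). \<gamma> \<bullet> \<gamma> = 1 \<and> \<gamma> $ 3 = sigma0_gamma3 i1 i3 a c1 \<and> K1 i3 \<omega> = sigma0_K1 i1 i3 a c1 \<and>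
             K2 i1 a \<omega> \<gamma> = 0 \<and> area_integral i1 i3 a \<omega> \<gamma> = sigma0_C i1 i3 a c1} \<and>
        (\<forall>(\<omega>0, \<gamma>0) \<in> sigma_0 i1 i3 a c1. \<exists>\<omega> \<gamma>.
           rolling_motion i1 i3 a \<mu> UNIV \<omega> \<gamma> \<and> \<omega> 0 = \<omega>0 \<and> \<gamma> 0 = \<gamma>0 \<and>
           (\<forall>t. (\<omega> t, \<gamma> t) \<in> sigma_0 i1 i3 a c1)) \<and>
        (\<forall>\<omega> \<gamma>. rolling_motion i1 i3 a \<mu> UNIV \<omega> \<gamma> \<and> (\<forall>t. (\<omega> t, \<gamma> t) \<in> sigma_0 i1 i3 a c1) \<longrightarrow>
           (\<exists>P>0. periodic_fun_simple (\<lambda>t. (\<omega> t, \<gamma> t)) P)) \<and>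
        reduced_fixed_point i1 i3 a \<mu> (sigma0_C i1 i3 a c1)
          (sigma0_gamma3 i1 i3 a c1, sigma0_K1 i1 i3 a c1, 0) \<and>
        (\<forall>(\<omega>, \<gamma>) \<in> sigma_0 i1 i3 a c1.
           inclination \<gamma> = arccos (sigma0_gamma3 i1 i3 a c1) \<and> inclination \<gamma> \<in> {0<..<pi}))) \<and>
     (\<forall>T \<omega> \<gamma>. permanent_rotation i1 i3 a \<mu> T \<omega> \<gamma> \<longrightarrow>
        (\<exists>C. \<forall>t\<in>T. (\<omega> t, \<gamma> t) \<in> sigma_u i1 i3 a C) \<or>
        (\<exists>C. \<forall>t\<in>T. (\<omega> t, \<gamma> t) \<in> sigma_l i1 i3 a C) \<or>
        (i1 \<noteq> i3 \<and> (\<exists>c1 \<in> sigma0_params i1 i3 a. \<forall>t\<in>T. (\<omega> t, \<gamma> t) \<in> sigma_0 i1 i3 a c1)))"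
proof (intro conjI allI ballI impI)
  fix T \<omega> \<gamma> assume "rolling_motion i1 i3 a \<mu> T \<omega> \<gamma>"
  then show "permanent_rotation i1 i3 a \<mu> T \<omega> \<gamma> \<longleftrightarrow>
          (\<forall>t\<in>T. ((\<lambda>s. \<gamma> s $ 3) has_real_derivative 0) (at t) \<and>
                 (deriv (\<lambda>s. \<gamma> s $ 3) has_real_derivative 0) (at t))"
    by (rule permanent_rotation_iff)
next
  fix C
  show u: "sigma_u i1 i3 a C = {(vector [0, 0, C / i3], vector [0, 0, 1])}"
    using assms(3) by (rule sigma_u_eq)
  show l: "sigma_l i1 i3 a C = {(vector [0, 0, - C / i3], vector [0, 0, - 1])}"
    using assms(3) by (rule sigma_l_eq)
  show "case s of (\<omega>, \<gamma>) \<Rightarrow>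
      fixed_point i1 i3 a \<mu> \<omega> \<gamma> \<and> area_integral i1 i3 a \<omega> \<gamma> = C \<and> mass_offset a \<bullet> \<gamma> > 0"
    if "s \<in> sigma_u i1 i3 a C" for s
    using that vertical_rotation[OF assms(3), where e = 1 and C = C] assms(1) by (simp add: u)
  show "case s of (\<omega>, \<gamma>) \<Rightarrow>
      fixed_point i1 i3 a \<mu> \<omega> \<gamma> \<and> area_integral i1 i3 a \<omega> \<gamma> = C \<and> mass_offset a \<bullet> \<gamma> < 0"
    if "s \<in> sigma_l i1 i3 a C" for s
    using that vertical_rotation[OF assms(3), where e = "- 1" and C = C] assms(1) by (simp add: l)
next
  fix c1 assume ne: "i1 \<noteq> i3" and params: "c1 \<in> sigma0_params i1 i3 a"
  then have c1: "c1 \<noteq> 0" "\<bar>sigma0_gamma3 i1 i3 a c1\<bar> < 1"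
    by (simp_all add: sigma0_params_iff[OF assms(1)])
  show "sigma_0 i1 i3 a c1 =
          {(\<omega>, \<gamma>). \<gamma> \<bullet> \<gamma> = 1 \<and> \<gamma> $ 3 = sigma0_gamma3 i1 i3 a c1 \<and> K1 i3 \<omega> = sigma0_K1 i1 i3 a c1 \<and>
             K2 i1 a \<omega> \<gamma> = 0 \<and> area_integral i1 i3 a \<omega> \<gamma> = sigma0_C i1 i3 a c1}"
    by (rule sigma_0_level_set[OF assms(2,3) ne c1])
  show "reduced_fixed_point i1 i3 a \<mu> (sigma0_C i1 i3 a c1)
          (sigma0_gamma3 i1 i3 a c1, sigma0_K1 i1 i3 a c1, 0)"
    by (rule sigma_0_reduced_fixed_point[OF assms(2,3) ne c1])
  show "case s of (\<omega>0, \<gamma>0) \<Rightarrow> \<exists>\<omega> \<gamma>.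
           rolling_motion i1 i3 a \<mu> UNIV \<omega> \<gamma> \<and> \<omega> 0 = \<omega>0 \<and> \<gamma> 0 = \<gamma>0 \<and>
           (\<forall>t. (\<omega> t, \<gamma> t) \<in> sigma_0 i1 i3 a c1)" if "s \<in> sigma_0 i1 i3 a c1" for s
  proof -
    obtain \<omega>0 \<gamma>0 where "s = (\<omega>0, \<gamma>0)"
      by (cases s)
    then show ?thesis
      using that sigma_0_fixed_point[OF ne c1] unfolding fixed_point_def by fastforce
  qed
  show "\<exists>P>0. periodic_fun_simple (\<lambda>t. (\<omega> t, \<gamma> t)) P"
    if "rolling_motion i1 i3 a \<mu> UNIV \<omega> \<gamma> \<and> (\<forall>t. (\<omega> t, \<gamma> t) \<in> sigma_0 i1 i3 a c1)" for \<omega> \<gamma>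
    using that sigma_0_periodic[OF ne c1, of \<mu> \<omega> \<gamma>] by (intro exI[of _ 1]) simp
  show "case s of (\<omega>, \<gamma>) \<Rightarrow>
           inclination \<gamma> = arccos (sigma0_gamma3 i1 i3 a c1) \<and> inclination \<gamma> \<in> {0<..<pi}"
    if "s \<in> sigma_0 i1 i3 a c1" for s
    using that sigma_0_inclination[OF ne c1] by (cases s) blast
next
  fix T \<omega> \<gamma> assume "permanent_rotation i1 i3 a \<mu> T \<omega> \<gamma>"
  then show "(\<exists>C. \<forall>t\<in>T. (\<omega> t, \<gamma> t) \<in> sigma_u i1 i3 a C) \<or>
        (\<exists>C. \<forall>t\<in>T. (\<omega> t, \<gamma> t) \<in> sigma_l i1 i3 a C) \<or>
        (i1 \<noteq> i3 \<and> (\<exists>c1 \<in> sigma0_params i1 i3 a. \<forall>t\<in>T. (\<omega> t, \<gamma> t) \<in> sigma_0 i1 i3 a c1))"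
    by (rule permanent_rotation_classification[OF assms])
qed

end
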